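(* Let $\Omega \subseteq \mathbb{C}^n$ be a domain with envelope of holomorphy $(\tilde\Omega, \pi)$ and associated inclusion $\alpha \colon \Omega \to \tilde\Omega$. Let $\Omega' = \pi(\tilde\Omega) \subseteq \mathbb{C}^n$ and let $i = \pi \circ \alpha \colon \Omega \to \Omega'$ (the inclusion map). If $\pi \colon \tilde\Omega \to \Omega'$ is a covering map, $\pi_1(\Omega')$ is a nilpotent group, and the induced map $i^* \colon H^1(\Omega' ; G) \to H^1(\Omega ; G)$ is injective for every abelian group $G$, then $(\tilde\Omega, \pi)$ is schlicht, i.e. $\pi \colon \tilde\Omega \to \Omega'$ is biholomorphic.
   Context: A domain is a nonempty connected open set. The envelope of holomorphy of a domain $\Omega \subseteq \mathbb{C}^n$ is a pair $(\tilde\Omega, \pi)$ consisting of a connected Stein manifold $\tilde\Omega$ and a locally biholomorphic map $\pi \colon \tilde\Omega \to \mathbb{C}^n$, together with a holomorphic inclusion $\alpha \colon \Omega \to \tilde\Omega$, characterized by the following properties: $\pi \circ \alpha$ is the identity on $\Omega$ (i.e. the inclusion of $\Omega$ into $\mathbb{C}^n$), and each holomorphic function $f$ on $\Omega$ has a unique holomorphic extension $F_f$ on $\tilde\Omega$ with $f = F_f \circ \alpha$. The envelope of holomorphy $(\tilde\Omega, \pi)$ is called schlicht if $\pi \colon \tilde\Omega \to \Omega' = \pi(\tilde\Omega)$ is biholomorphic. $H^1(X; G)$ denotes singular cohomology with coefficients in $G$ (equivalently, for these manifolds, Čech cohomology with coefficients in the sheaf of locally constant $G$-valued functions). *)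

theory Defs
  imports "HOL-Analysis.Analysis" "HOL-Homology.Homology"
begin

section \<open>Holomorphic functions of several complex variables\<close>

text \<open>Complex differentiability is real differentiability with a complex linear derivative.
  Since \<open>at z\<close> is not restricted to \<open>S\<close>, these notions are meant for open \<open>S\<close> only.\<close>

definition scv_holomorphic_on :: "(complex^'n \<Rightarrow> complex) \<Rightarrow> (complex^'n) set \<Rightarrow> bool" where
  "scv_holomorphic_on f S \<longleftrightarrow>
     (\<forall>z\<in>S. \<exists>f'. (f has_derivative f') (at z) \<and> (\<forall>c v. f' (c *s v) = c * f' v))"

definition scv_holomorphic_map_on :: "(complex^'n \<Rightarrow> complex^'m) \<Rightarrow> (complex^'n) set \<Rightarrow> bool" where
  "scv_holomorphic_map_on f S \<longleftrightarrow> (\<forall>i. scv_holomorphic_on (\<lambda>z. f z $ i) S)"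


section \<open>Complex manifolds\<close>

text \<open>The points of a manifold form a set \<open>M\<close> (with the subspace topology) in a type whose
  topology is Hausdorff and second countable; an atlas is a set of pairs \<open>(U, \<phi>)\<close> of a chart
  domain and a coordinate map.\<close>

type_synonym ('a, 'n) charts = "('a set \<times> ('a \<Rightarrow> complex^'n)) set"

definition complex_manifold ::
  "'a::{t2_space,second_countable_topology} set \<Rightarrow> ('a, 'n::finite) charts \<Rightarrow> bool" where
  "complex_manifold M A \<longleftrightarrow>
     (\<Union>(U,\<phi>)\<in>A. U) = M \<and>
     (\<forall>(U,\<phi>)\<in>A. openin (top_of_set M) U \<and> open (\<phi> ` U) \<and>
        homeomorphism U (\<phi> ` U) \<phi> (inv_into U \<phi>)) \<and>
     (\<forall>(U,\<phi>)\<in>A. \<forall>(V,\<psi>)\<in>A. scv_holomorphic_map_on (\<psi> \<circ> inv_into U \<phi>) (\<phi> ` (U \<inter> V)))"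

definition restrict_charts :: "('a, 'n::finite) charts \<Rightarrow> 'a set \<Rightarrow> ('a, 'n::finite) charts" where
  "restrict_charts A W = (\<lambda>(U,\<phi>). (U \<inter> W, \<phi>)) ` A"

text \<open>The standard structure of an open subset of \<open>\<complex>\<^sup>n\<close>.\<close>

definition std_charts :: "(complex^'n) set \<Rightarrow> (complex^'n, 'n) charts" where
  "std_charts S = {(S, id)}"

definition holomorphic_function :: "('a, 'n::finite) charts \<Rightarrow> ('a \<Rightarrow> complex) \<Rightarrow> bool" where
  "holomorphic_function A F \<longleftrightarrow> (\<forall>(U,\<phi>)\<in>A. scv_holomorphic_on (F \<circ> inv_into U \<phi>) (\<phi> ` U))"

definition holomorphic_map ::
  "'a::topological_space set \<Rightarrow> ('a, 'n::finite) charts \<Rightarrow> 'b::topological_space set \<Rightarrow> ('b, 'm::finite) charts \<Rightarrow>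
   ('a \<Rightarrow> 'b) \<Rightarrow> bool" where
  "holomorphic_map M A N B f \<longleftrightarrow>
     continuous_on M f \<and> f ` M \<subseteq> N \<and>
     (\<forall>(U,\<phi>)\<in>A. \<forall>(V,\<psi>)\<in>B.
        scv_holomorphic_map_on (\<psi> \<circ> f \<circ> inv_into U \<phi>) (\<phi> ` (U \<inter> f -` V)))"

definition biholomorphic_map ::
  "'a::topological_space set \<Rightarrow> ('a, 'n::finite) charts \<Rightarrow> 'b::topological_space set \<Rightarrow> ('b, 'm::finite) charts \<Rightarrow>
   ('a \<Rightarrow> 'b) \<Rightarrow> bool" where
  "biholomorphic_map M A N B f \<longleftrightarrow>
     bij_betw f M N \<and> holomorphic_map M A N B f \<and> holomorphic_map N B M A (inv_into M f)"

definition locally_biholomorphic_map ::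
  "'a::topological_space set \<Rightarrow> ('a, 'n::finite) charts \<Rightarrow> 'b::topological_space set \<Rightarrow> ('b, 'm::finite) charts \<Rightarrow>
   ('a \<Rightarrow> 'b) \<Rightarrow> bool" where
  "locally_biholomorphic_map M A N B f \<longleftrightarrow>
     (\<forall>x\<in>M. \<exists>U V. x \<in> U \<and> openin (top_of_set M) U \<and> openin (top_of_set N) V \<and>
        biholomorphic_map U (restrict_charts A U) V (restrict_charts B V) f)"


section \<open>Stein manifolds and envelopes of holomorphy\<close>

text \<open>For nonempty compact \<open>K\<close> the supremum below is over a bounded nonempty set.\<close>

definition holomorphic_hull :: "'a set \<Rightarrow> ('a, 'n::finite) charts \<Rightarrow> 'a set \<Rightarrow> 'a set" where
  "holomorphic_hull M A K =
     {x\<in>M. \<forall>F. holomorphic_function A F \<longrightarrow> cmod (F x) \<le> (SUP y\<in>K. cmod (F y))}"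

text \<open>Existence of local coordinates given by global holomorphic functions, sometimes listed as a
  third axiom, follows from holomorphic convexity and separability (and for a manifold spread over
  \<open>\<complex>\<^sup>n\<close> it is immediate, the components of the projection being such coordinates).\<close>

definition stein_manifold ::
  "'a::{t2_space,second_countable_topology} set \<Rightarrow> ('a, 'n::finite) charts \<Rightarrow> bool" where
  "stein_manifold M A \<longleftrightarrow>
     complex_manifold M A \<and>
     (\<forall>K. compact K \<and> K \<subseteq> M \<and> K \<noteq> {} \<longrightarrow> compact (holomorphic_hull M A K)) \<and>
     (\<forall>x\<in>M. \<forall>y\<in>M. x \<noteq> y \<longrightarrow> (\<exists>F. holomorphic_function A F \<and> F x \<noteq> F y))"

text \<open>Functions on \<open>M\<close> are total functions on the underlying type; \<open>extensional M\<close> fixes the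
  irrelevant values outside \<open>M\<close>, so that uniqueness means uniqueness on \<open>M\<close>.\<close>

definition envelope_of_holomorphy ::
  "(complex^'n) set \<Rightarrow> 'a::{t2_space,second_countable_topology} set \<Rightarrow> ('a, 'n::finite) charts \<Rightarrow>
   ('a \<Rightarrow> complex^'n) \<Rightarrow> (complex^'n \<Rightarrow> 'a) \<Rightarrow> bool" where
  "envelope_of_holomorphy \<Omega> M A \<pi> \<alpha> \<longleftrightarrow>
     stein_manifold M A \<and> connected M \<and>
     locally_biholomorphic_map M A UNIV (std_charts UNIV) \<pi> \<and>
     holomorphic_map \<Omega> (std_charts \<Omega>) M A \<alpha> \<and> inj_on \<alpha> \<Omega> \<and>
     (\<forall>z\<in>\<Omega>. \<pi> (\<alpha> z) = z) \<and>
     (\<forall>f. scv_holomorphic_on f \<Omega> \<longrightarrow>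
        (\<exists>!F. F \<in> extensional M \<and> holomorphic_function A F \<and> (\<forall>z\<in>\<Omega>. F (\<alpha> z) = f z)))"

definition schlicht ::
  "'a::topological_space set \<Rightarrow> ('a, 'n::finite) charts \<Rightarrow> ('a \<Rightarrow> complex^'n) \<Rightarrow> bool" where
  "schlicht M A \<pi> \<longleftrightarrow> biholomorphic_map M A (\<pi> ` M) (std_charts (\<pi> ` M)) \<pi>"


section \<open>The fundamental group\<close>

definition path_class :: "'a::topological_space set \<Rightarrow> (real \<Rightarrow> 'a) \<Rightarrow> (real \<Rightarrow> 'a) set" where
  "path_class S p = {q. homotopic_paths S p q}"

definition loops_at :: "'a::topological_space set \<Rightarrow> 'a \<Rightarrow> (real \<Rightarrow> 'a) set" where
  "loops_at S a = {p. path p \<and> path_image p \<subseteq> S \<and> pathstart p = a \<and> pathfinish p = a}"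

text \<open>All members of the union in the product are equal, see \<open>mult_path_class\<close> below.\<close>

definition fundamental_group ::
  "'a::real_normed_vector set \<Rightarrow> 'a \<Rightarrow> (real \<Rightarrow> 'a) set monoid" where
  "fundamental_group S a =
     \<lparr>carrier = path_class S ` loops_at S a,
      monoid.mult = (\<lambda>P Q. \<Union>p\<in>P. \<Union>q\<in>Q. path_class S (p +++ q)),
      one = path_class S (linepath a a)\<rparr>"

lemma path_class_eq_iff:
  "path p \<Longrightarrow> path_image p \<subseteq> S \<Longrightarrow> path_class S p = path_class S q \<longleftrightarrow> homotopic_paths S p q"
  by (auto simp: path_class_def set_eq_iff
      intro: homotopic_paths_refl[THEN iffD2] homotopic_paths_trans homotopic_paths_sym)

lemma mult_path_class:
  assumes "p \<in> loops_at S a" "q \<in> loops_at S a"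
  shows "path_class S p \<otimes>\<^bsub>fundamental_group S a\<^esub> path_class S q = path_class S (p +++ q)"
proof -
  have "path_class S (p' +++ q') = path_class S (p +++ q)"
    if "p' \<in> path_class S p" "q' \<in> path_class S q" for p' q'
  proof -
    have "homotopic_paths S (p +++ q) (p' +++ q')"
      using that assms by (auto simp: path_class_def loops_at_def intro!: homotopic_paths_join)
    then show ?thesis
      by (metis homotopic_paths_imp_path homotopic_paths_imp_subset path_class_eq_iff)
  qed
  moreover have "p \<in> path_class S p" "q \<in> path_class S q"
    using assms by (auto simp: path_class_def loops_at_def)
  ultimately have "(\<Union>p'\<in>path_class S p. \<Union>q'\<in>path_class S q. path_class S (p' +++ q')) = path_class S (p +++ q)"
    by blast
  then show ?thesis
    by (simp add: fundamental_group_def)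
qed

lemma loops_at_join: "p \<in> loops_at S a \<Longrightarrow> q \<in> loops_at S a \<Longrightarrow> p +++ q \<in> loops_at S a"
  by (auto simp: loops_at_def path_image_join)

lemma group_fundamental_group:
  assumes "a \<in> S"
  shows "group (fundamental_group S a)"
proof (rule groupI)
  have const: "linepath a a \<in> loops_at S a"
    using assms by (auto simp: loops_at_def)
  have carr: "x \<in> carrier (fundamental_group S a) \<longleftrightarrow> (\<exists>p\<in>loops_at S a. x = path_class S p)" for x
    by (auto simp: fundamental_group_def)
  have one: "\<one>\<^bsub>fundamental_group S a\<^esub> = path_class S (linepath a a)"
    by (simp add: fundamental_group_def)
  show "\<one>\<^bsub>fundamental_group S a\<^esub> \<in> carrier (fundamental_group S a)"
    using const by (auto simp: carr one)
  show "x \<otimes>\<^bsub>fundamental_group S a\<^esub> y \<in> carrier (fundamental_group S a)"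
    if "x \<in> carrier (fundamental_group S a)" "y \<in> carrier (fundamental_group S a)" for x y
    using that unfolding carr by (metis mult_path_class loops_at_join)
  show "x \<otimes>\<^bsub>fundamental_group S a\<^esub> y \<otimes>\<^bsub>fundamental_group S a\<^esub> z =
        x \<otimes>\<^bsub>fundamental_group S a\<^esub> (y \<otimes>\<^bsub>fundamental_group S a\<^esub> z)"
    if xyz: "x \<in> carrier (fundamental_group S a)" "y \<in> carrier (fundamental_group S a)"
      "z \<in> carrier (fundamental_group S a)" for x y z
  proof -
    obtain p q r where pqr: "p \<in> loops_at S a" "q \<in> loops_at S a" "r \<in> loops_at S a"
      "x = path_class S p" "y = path_class S q" "z = path_class S r"
      using xyz by (auto simp: carr)
    have "homotopic_paths S (p +++ (q +++ r)) ((p +++ q) +++ r)"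
      using pqr by (intro homotopic_paths_assoc) (auto simp: loops_at_def)
    then have "path_class S ((p +++ q) +++ r) = path_class S (p +++ (q +++ r))"
      by (metis homotopic_paths_imp_path homotopic_paths_imp_subset path_class_eq_iff)
    then show ?thesis
      using pqr by (simp add: mult_path_class loops_at_join)
  qed
  show "\<one>\<^bsub>fundamental_group S a\<^esub> \<otimes>\<^bsub>fundamental_group S a\<^esub> x = x"
    if "x \<in> carrier (fundamental_group S a)" for x
  proof -
    obtain p where p: "p \<in> loops_at S a" "x = path_class S p"
      using \<open>x \<in> _\<close> by (auto simp: carr)
    have "homotopic_paths S (linepath a a +++ p) p"
      using p by (intro homotopic_paths_lid') (auto simp: loops_at_def)
    then have "path_class S (linepath a a +++ p) = path_class S p"
      by (metis homotopic_paths_imp_path homotopic_paths_imp_subset path_class_eq_iff)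
    then show ?thesis
      using p const by (simp add: one mult_path_class)
  qed
  show "\<exists>y\<in>carrier (fundamental_group S a). y \<otimes>\<^bsub>fundamental_group S a\<^esub> x = \<one>\<^bsub>fundamental_group S a\<^esub>"
    if "x \<in> carrier (fundamental_group S a)" for x
  proof -
    obtain p where p: "p \<in> loops_at S a" "x = path_class S p"
      using \<open>x \<in> _\<close> by (auto simp: carr)
    have r: "reversepath p \<in> loops_at S a"
      using p by (auto simp: loops_at_def)
    have "homotopic_paths S (reversepath p +++ p) (linepath a a)"
      using p homotopic_paths_linv[of p S] by (auto simp: loops_at_def)
    then have "path_class S (reversepath p +++ p) = path_class S (linepath a a)"
      by (metis homotopic_paths_imp_path homotopic_paths_imp_subset path_class_eq_iff)
    then show ?thesis
      using p r by (intro bexI[of _ "path_class S (reversepath p)"]) (auto simp: carr one mult_path_class)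
  qed
qed

primrec lower_central_series :: "('a, 'b) monoid_scheme \<Rightarrow> nat \<Rightarrow> 'a set" where
  "lower_central_series G 0 = carrier G"
| "lower_central_series G (Suc k) =
     generate G (\<Union>h\<in>lower_central_series G k. \<Union>g\<in>carrier G.
       {h \<otimes>\<^bsub>G\<^esub> g \<otimes>\<^bsub>G\<^esub> inv\<^bsub>G\<^esub> h \<otimes>\<^bsub>G\<^esub> inv\<^bsub>G\<^esub> g})"

definition nilpotent_group :: "('a, 'b) monoid_scheme \<Rightarrow> bool" where
  "nilpotent_group G \<longleftrightarrow> group G \<and> (\<exists>k. lower_central_series G k = {\<one>\<^bsub>G\<^esub>})"


section \<open>Singular cohomology with coefficients\<close>

text \<open>Cochains are homomorphisms from the singular chain group into the (multiplicatively written)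
  coefficient group, made extensional so that cochains agreeing on all chains are equal.\<close>

definition cochain_group ::
  "nat \<Rightarrow> 'a topology \<Rightarrow> ('g, 'm) monoid_scheme \<Rightarrow> ('a chain \<Rightarrow> 'g) monoid" where
  "cochain_group p X G =
     \<lparr>carrier = hom (chain_group p X) G \<inter> extensional (singular_chain_set p X),
      monoid.mult = (\<lambda>u v. \<lambda>c\<in>singular_chain_set p X. u c \<otimes>\<^bsub>G\<^esub> v c),
      one = (\<lambda>c\<in>singular_chain_set p X. \<one>\<^bsub>G\<^esub>)\<rparr>"

definition cochain_coboundary :: "nat \<Rightarrow> 'a topology \<Rightarrow> ('a chain \<Rightarrow> 'g) \<Rightarrow> 'a chain \<Rightarrow> 'g" where
  "cochain_coboundary p X u = (\<lambda>c\<in>singular_chain_set (Suc p) X. u (chain_boundary (Suc p) c))"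

definition cocycle_set :: "nat \<Rightarrow> 'a topology \<Rightarrow> ('g, 'm) monoid_scheme \<Rightarrow> ('a chain \<Rightarrow> 'g) set" where
  "cocycle_set p X G =
     kernel (cochain_group p X G) (cochain_group (Suc p) X G) (cochain_coboundary p X)"

definition coboundary_set :: "nat \<Rightarrow> 'a topology \<Rightarrow> ('g, 'm) monoid_scheme \<Rightarrow> ('a chain \<Rightarrow> 'g) set" where
  "coboundary_set p X G =
     (if p = 0 then {\<one>\<^bsub>cochain_group 0 X G\<^esub>}
      else cochain_coboundary (p - 1) X ` carrier (cochain_group (p - 1) X G))"

definition cocycle_group ::
  "nat \<Rightarrow> 'a topology \<Rightarrow> ('g, 'm) monoid_scheme \<Rightarrow> ('a chain \<Rightarrow> 'g) monoid" where
  "cocycle_group p X G = (cochain_group p X G)\<lparr>carrier := cocycle_set p X G\<rparr>"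

definition cohomology_group ::
  "nat \<Rightarrow> 'a topology \<Rightarrow> ('g, 'm) monoid_scheme \<Rightarrow> ('a chain \<Rightarrow> 'g) set monoid" where
  "cohomology_group p X G = cocycle_group p X G Mod coboundary_set p X G"

definition cochain_map ::
  "nat \<Rightarrow> 'a topology \<Rightarrow> ('a \<Rightarrow> 'b) \<Rightarrow> ('b chain \<Rightarrow> 'g) \<Rightarrow> 'a chain \<Rightarrow> 'g" where
  "cochain_map p X f u = (\<lambda>c\<in>singular_chain_set p X. u (chain_map p f c))"

text \<open>The map \<open>H\<^sup>p(Y; G) \<rightarrow> H\<^sup>p(X; G)\<close> induced by \<open>f : X \<rightarrow> Y\<close>. Cohomology classes are cosets;
  all members of the union are equal, see \<open>cohomology_induced_coset\<close> below.\<close>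

definition cohomology_induced ::
  "nat \<Rightarrow> 'a topology \<Rightarrow> ('g, 'm) monoid_scheme \<Rightarrow> ('a \<Rightarrow> 'b) \<Rightarrow>
   ('b chain \<Rightarrow> 'g) set \<Rightarrow> ('a chain \<Rightarrow> 'g) set" where
  "cohomology_induced p X G f K =
     (\<Union>u\<in>K. coboundary_set p X G #>\<^bsub>cocycle_group p X G\<^esub> cochain_map p X f u)"


context
  fixes G :: "('g, 'm) monoid_scheme"
  assumes G: "comm_group G"
begin

interpretation G: comm_group G by (rule G)

lemma cochain_hom:
  assumes "u \<in> carrier (cochain_group p X G)"
  shows "group_hom (chain_group p X) G u"
  using assms by (auto simp: cochain_group_def group_hom_def group_hom_axioms_def)

lemma carrier_cochain_group:
  "u \<in> carrier (cochain_group p X G) \<longleftrightarrow>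
     u \<in> extensional (singular_chain_set p X) \<and>
     (\<forall>c. singular_chain p X c \<longrightarrow> u c \<in> carrier G) \<and>
     (\<forall>c d. singular_chain p X c \<and> singular_chain p X d \<longrightarrow> u (c + d) = u c \<otimes>\<^bsub>G\<^esub> u d)"
  by (auto simp: cochain_group_def hom_def)

lemma mult_cochain_group:
  "singular_chain p X c \<Longrightarrow> (u \<otimes>\<^bsub>cochain_group p X G\<^esub> v) c = u c \<otimes>\<^bsub>G\<^esub> v c"
  by (simp add: cochain_group_def)

lemma one_cochain_group:
  "singular_chain p X c \<Longrightarrow> \<one>\<^bsub>cochain_group p X G\<^esub> c = \<one>\<^bsub>G\<^esub>"
  by (simp add: cochain_group_def)

lemma comm_group_cochain_group: "comm_group (cochain_group p X G)"
proof (rule comm_groupI)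
  fix u assume u: "u \<in> carrier (cochain_group p X G)"
  have cl: "singular_chain p X c \<Longrightarrow> u c \<in> carrier G" for c
    using u by (auto simp: carrier_cochain_group)
  let ?v = "\<lambda>c\<in>singular_chain_set p X. inv\<^bsub>G\<^esub> u c"
  have "?v \<in> carrier (cochain_group p X G)"
    using u by (auto simp: carrier_cochain_group G.inv_mult singular_chain_add)
  moreover have "?v \<otimes>\<^bsub>cochain_group p X G\<^esub> u = \<one>\<^bsub>cochain_group p X G\<^esub>"
    using cl by (auto simp: cochain_group_def)
  ultimately show "\<exists>v\<in>carrier (cochain_group p X G). v \<otimes>\<^bsub>cochain_group p X G\<^esub> u = \<one>\<^bsub>cochain_group p X G\<^esub>"
    by blast
  show "\<one>\<^bsub>cochain_group p X G\<^esub> \<otimes>\<^bsub>cochain_group p X G\<^esub> u = u"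
    using u cl by (intro extensionalityI[of _ "singular_chain_set p X"])
      (auto simp: cochain_group_def)
next
  fix u v assume u: "u \<in> carrier (cochain_group p X G)" and v: "v \<in> carrier (cochain_group p X G)"
  have cl: "singular_chain p X c \<Longrightarrow> u c \<in> carrier G"
      "singular_chain p X c \<Longrightarrow> v c \<in> carrier G" for c
    using u v by (auto simp: carrier_cochain_group)
  show "u \<otimes>\<^bsub>cochain_group p X G\<^esub> v \<in> carrier (cochain_group p X G)"
    using u v by (auto simp: carrier_cochain_group mult_cochain_group singular_chain_add G.m_ac cl)
      (auto simp: cochain_group_def)
  show "u \<otimes>\<^bsub>cochain_group p X G\<^esub> v = v \<otimes>\<^bsub>cochain_group p X G\<^esub> u"
    using cl by (auto simp: cochain_group_def G.m_comm)
  fix w assume w: "w \<in> carrier (cochain_group p X G)"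
  then have "singular_chain p X c \<Longrightarrow> w c \<in> carrier G" for c
    by (auto simp: carrier_cochain_group)
  then show "u \<otimes>\<^bsub>cochain_group p X G\<^esub> v \<otimes>\<^bsub>cochain_group p X G\<^esub> w =
      u \<otimes>\<^bsub>cochain_group p X G\<^esub> (v \<otimes>\<^bsub>cochain_group p X G\<^esub> w)"
    using cl by (auto simp: cochain_group_def G.m_assoc)
next
  show "\<one>\<^bsub>cochain_group p X G\<^esub> \<in> carrier (cochain_group p X G)"
    by (auto simp: carrier_cochain_group one_cochain_group singular_chain_add)
      (auto simp: cochain_group_def)
qed

lemma cochain_ext:
  assumes "u \<in> carrier (cochain_group p X G)" "v \<in> carrier (cochain_group p X G)"
    "\<And>c. singular_chain p X c \<Longrightarrow> u c = v c"
  shows "u = v"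
  using assms by (auto simp: carrier_cochain_group intro: extensionalityI)

lemma coboundary_group_hom:
  "group_hom (cochain_group p X G) (cochain_group (Suc p) X G) (cochain_coboundary p X)"
proof -
  have bd: "singular_chain (Suc p) X c \<Longrightarrow> singular_chain p X (chain_boundary (Suc p) c)" for c
    using singular_chain_boundary[of "Suc p" X c] by simp
  have 1: "cochain_coboundary p X u \<in> carrier (cochain_group (Suc p) X G)"
    if "u \<in> carrier (cochain_group p X G)" for u
    using that bd
    by (auto simp: carrier_cochain_group cochain_coboundary_def singular_chain_add chain_boundary_add)
  have 2: "cochain_coboundary p X (u \<otimes>\<^bsub>cochain_group p X G\<^esub> v) =
      cochain_coboundary p X u \<otimes>\<^bsub>cochain_group (Suc p) X G\<^esub> cochain_coboundary p X v" for u v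
    using bd by (auto simp: cochain_coboundary_def mult_cochain_group) (auto simp: cochain_group_def)
  show ?thesis
    using 1 2 by (auto simp: group_hom_def group_hom_axioms_def hom_def comm_group.axioms(2)[OF comm_group_cochain_group])
qed

lemma cochain_map_group_hom:
  assumes f: "continuous_map X Y f"
  shows "group_hom (cochain_group p Y G) (cochain_group p X G) (cochain_map p X f)"
proof -
  have ch: "singular_chain p X c \<Longrightarrow> singular_chain p Y (chain_map p f c)" for c
    using f by (simp add: singular_chain_chain_map)
  have 1: "cochain_map p X f u \<in> carrier (cochain_group p X G)"
    if "u \<in> carrier (cochain_group p Y G)" for u
    using that ch
    by (auto simp: carrier_cochain_group cochain_map_def singular_chain_add chain_map_add)
  have 2: "cochain_map p X f (u \<otimes>\<^bsub>cochain_group p Y G\<^esub> v) =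
      cochain_map p X f u \<otimes>\<^bsub>cochain_group p X G\<^esub> cochain_map p X f v" for u v
    using ch by (auto simp: cochain_map_def mult_cochain_group) (auto simp: cochain_group_def)
  show ?thesis
    using 1 2 by (auto simp: group_hom_def group_hom_axioms_def hom_def comm_group.axioms(2)[OF comm_group_cochain_group])
qed

lemma cochain_map_coboundary:
  assumes f: "continuous_map X Y f"
  shows "cochain_coboundary p X (cochain_map p X f u) = cochain_map (Suc p) X f (cochain_coboundary p Y u)"
  using singular_chain_boundary[of "Suc p" X] f
  by (auto simp: cochain_map_def cochain_coboundary_def chain_boundary_chain_map singular_chain_chain_map)

lemma cocycle_set_subgroup: "subgroup (cocycle_set p X G) (cochain_group p X G)"
  unfolding cocycle_set_def by (rule group_hom.subgroup_kernel[OF coboundary_group_hom])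

lemma comm_group_cocycle_group: "comm_group (cocycle_group p X G)"
proof (rule group.group_comm_groupI)
  show "group (cocycle_group p X G)"
    unfolding cocycle_group_def
    by (rule subgroup.subgroup_is_group[OF cocycle_set_subgroup comm_group.axioms(2)[OF comm_group_cochain_group]])
  show "u \<otimes>\<^bsub>cocycle_group p X G\<^esub> v = v \<otimes>\<^bsub>cocycle_group p X G\<^esub> u"
    if "u \<in> carrier (cocycle_group p X G)" "v \<in> carrier (cocycle_group p X G)" for u v
    using that comm_monoid.m_comm[OF comm_group.axioms(1)[OF comm_group_cochain_group],
        OF subgroup.mem_carrier[OF cocycle_set_subgroup] subgroup.mem_carrier[OF cocycle_set_subgroup]]
    by (simp add: cocycle_group_def)
qed

lemma coboundary_set_subgroup: "subgroup (coboundary_set p X G) (cochain_group p X G)"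
proof (cases p)
  case 0
  then show ?thesis
    by (simp add: coboundary_set_def group.triv_subgroup comm_group.axioms(2)[OF comm_group_cochain_group])
next
  case (Suc q)
  then show ?thesis
    using group_hom.img_is_subgroup[OF coboundary_group_hom, of q X] by (simp add: coboundary_set_def)
qed

lemma coboundary_subset_cocycle: "coboundary_set p X G \<subseteq> cocycle_set p X G"
proof (cases p)
  case 0
  then show ?thesis
    using subgroup.one_closed[OF cocycle_set_subgroup] by (auto simp: coboundary_set_def)
next
  case (Suc q)
  have "cochain_coboundary (Suc q) X (cochain_coboundary q X u) = \<one>\<^bsub>cochain_group (Suc (Suc q)) X G\<^esub>"
    if u: "u \<in> carrier (cochain_group q X G)" for u
  proof -
    have "u 0 = \<one>\<^bsub>G\<^esub>"
      using group_hom.hom_one[OF cochain_hom[OF u]] by simp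
    then show ?thesis
      using singular_chain_boundary[of "Suc (Suc q)" X]
      by (auto simp: cochain_coboundary_def cochain_group_def chain_boundary_boundary_alt)
  qed
  then show ?thesis
    using Suc group_hom.hom_closed[OF coboundary_group_hom, of _ q X]
    by (auto simp: coboundary_set_def cocycle_set_def kernel_def)
qed

lemma coboundary_set_subgroup_cocycle: "subgroup (coboundary_set p X G) (cocycle_group p X G)"
  unfolding cocycle_group_def
  by (intro group.subgroup_incl comm_group.axioms(2)[OF comm_group_cochain_group]
      coboundary_set_subgroup cocycle_set_subgroup coboundary_subset_cocycle)

lemma comm_group_cohomology_group: "comm_group (cohomology_group p X G)"
  unfolding cohomology_group_def
  by (intro comm_group.abelian_FactGroup comm_group_cocycle_group coboundary_set_subgroup_cocycle)

lemma cochain_map_cocycle: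
  assumes f: "continuous_map X Y f" and u: "u \<in> cocycle_set p Y G"
  shows "cochain_map p X f u \<in> cocycle_set p X G"
proof -
  have "cochain_coboundary p X (cochain_map p X f u) =
      cochain_map (Suc p) X f \<one>\<^bsub>cochain_group (Suc p) Y G\<^esub>"
    using u by (simp add: cochain_map_coboundary[OF f] cocycle_set_def kernel_def)
  also have "\<dots> = \<one>\<^bsub>cochain_group (Suc p) X G\<^esub>"
    by (rule group_hom.hom_one[OF cochain_map_group_hom[OF f]])
  finally show ?thesis
    using u group_hom.hom_closed[OF cochain_map_group_hom[OF f]] by (auto simp: cocycle_set_def kernel_def)
qed

lemma cochain_map_coboundary_set:
  assumes f: "continuous_map X Y f" and u: "u \<in> coboundary_set p Y G"
  shows "cochain_map p X f u \<in> coboundary_set p X G"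
proof (cases p)
  case 0
  then show ?thesis
    using u group_hom.hom_one[OF cochain_map_group_hom[OF f]] by (auto simp: coboundary_set_def)
next
  case (Suc q)
  then obtain w where w: "w \<in> carrier (cochain_group q Y G)" "u = cochain_coboundary q Y w"
    using u by (auto simp: coboundary_set_def)
  have "cochain_map p X f u = cochain_coboundary q X (cochain_map q X f w)"
    unfolding Suc w(2) by (rule cochain_map_coboundary[OF f, symmetric])
  then show ?thesis
    using group_hom.hom_closed[OF cochain_map_group_hom[OF f] w(1)] Suc by (simp add: coboundary_set_def)
qed

lemma cocycle_map_group_hom:
  assumes f: "continuous_map X Y f"
  shows "group_hom (cocycle_group p Y G) (cocycle_group p X G) (cochain_map p X f)"
proof -
  have "cochain_map p X f \<in> hom (cocycle_group p Y G) (cocycle_group p X G)"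
  proof (rule homI)
    fix u v assume "u \<in> carrier (cocycle_group p Y G)" "v \<in> carrier (cocycle_group p Y G)"
    then have "u \<in> cocycle_set p Y G" "v \<in> cocycle_set p Y G"
      by (simp_all add: cocycle_group_def)
    from this[THEN subgroup.mem_carrier[OF cocycle_set_subgroup]]
    show "cochain_map p X f (u \<otimes>\<^bsub>cocycle_group p Y G\<^esub> v) =
        cochain_map p X f u \<otimes>\<^bsub>cocycle_group p X G\<^esub> cochain_map p X f v"
      using group_hom.hom_mult[OF cochain_map_group_hom[OF f]] by (simp add: cocycle_group_def)
  qed (simp add: cocycle_group_def cochain_map_cocycle[OF f])
  then show ?thesis
    by (simp add: group_hom_def group_hom_axioms_def comm_group.axioms(2)[OF comm_group_cocycle_group])
qed

lemma cohomology_induced_coset: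
  assumes f: "continuous_map X Y f" and u: "u \<in> cocycle_set p Y G"
  shows "cohomology_induced p X G f (coboundary_set p Y G #>\<^bsub>cocycle_group p Y G\<^esub> u) =
         coboundary_set p X G #>\<^bsub>cocycle_group p X G\<^esub> cochain_map p X f u"
proof -
  interpret h: group_hom "cocycle_group p Y G" "cocycle_group p X G" "cochain_map p X f"
    by (rule cocycle_map_group_hom[OF f])
  have cY: "carrier (cocycle_group p Y G) = cocycle_set p Y G"
    by (simp add: cocycle_group_def)
  have "coboundary_set p X G #>\<^bsub>cocycle_group p X G\<^esub> cochain_map p X f v =
        coboundary_set p X G #>\<^bsub>cocycle_group p X G\<^esub> cochain_map p X f u"
    if v: "v \<in> coboundary_set p Y G #>\<^bsub>cocycle_group p Y G\<^esub> u" for v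
  proof -
    obtain b where b: "b \<in> coboundary_set p Y G" "v = b \<otimes>\<^bsub>cocycle_group p Y G\<^esub> u"
      using v by (auto simp: r_coset_def)
    have "cochain_map p X f v = cochain_map p X f b \<otimes>\<^bsub>cocycle_group p X G\<^esub> cochain_map p X f u"
      using b u coboundary_subset_cocycle[THEN subsetD, OF b(1)] by (auto simp: cY intro!: h.hom_mult)
    then have "cochain_map p X f v \<in> coboundary_set p X G #>\<^bsub>cocycle_group p X G\<^esub> cochain_map p X f u"
      using cochain_map_coboundary_set[OF f b(1)] by (auto simp: r_coset_def)
    moreover have "cochain_map p X f u \<in> carrier (cocycle_group p X G)"
      using h.hom_closed u unfolding cY by blast
    ultimately show ?thesis
      using h.H.repr_independence[OF _ _ coboundary_set_subgroup_cocycle] by metis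
  qed
  moreover have "u \<in> coboundary_set p Y G #>\<^bsub>cocycle_group p Y G\<^esub> u"
    using h.G.rcos_self[OF _ coboundary_set_subgroup_cocycle, of u] u unfolding cY by simp
  ultimately show ?thesis
    unfolding cohomology_induced_def by blast
qed

lemma inj_cohomology_induced_iff:
  assumes f: "continuous_map X Y f"
  shows "inj_on (cohomology_induced p X G f) (carrier (cohomology_group p Y G)) \<longleftrightarrow>
    (\<forall>u\<in>cocycle_set p Y G. cochain_map p X f u \<in> coboundary_set p X G \<longrightarrow> u \<in> coboundary_set p Y G)"
    (is "?L \<longleftrightarrow> ?R")
proof -
  interpret h: group_hom "cocycle_group p Y G" "cocycle_group p X G" "cochain_map p X f"
    by (rule cocycle_map_group_hom[OF f])
  have cY: "carrier (cocycle_group p Y G) = cocycle_set p Y G"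
    and cX: "carrier (cocycle_group p X G) = cocycle_set p X G"
    by (simp_all add: cocycle_group_def)
  have carr: "carrier (cohomology_group p Y G) =
      (\<lambda>u. coboundary_set p Y G #>\<^bsub>cocycle_group p Y G\<^esub> u) ` cocycle_set p Y G"
    by (simp add: cohomology_group_def carrier_FactGroup cY)
  note BY = coboundary_set_subgroup_cocycle[of p Y] and BX = coboundary_set_subgroup_cocycle[of p X]
  have mem: "u \<in> coboundary_set p Y G" if "u \<in> cocycle_set p Y G"
      "coboundary_set p Y G #>\<^bsub>cocycle_group p Y G\<^esub> u = coboundary_set p Y G" for u
    using h.G.rcos_self[OF _ BY, of u] that unfolding cY by simp
  show ?thesis
  proof
    assume L: ?L
    show ?R
    proof (intro ballI impI)
      fix u assume u: "u \<in> cocycle_set p Y G" and fu: "cochain_map p X f u \<in> coboundary_set p X G"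
      let ?e = "\<one>\<^bsub>cocycle_group p Y G\<^esub>"
      have e: "?e \<in> cocycle_set p Y G"
        using h.G.one_closed cY by simp
      have 1: "coboundary_set p X G #>\<^bsub>cocycle_group p X G\<^esub> cochain_map p X f u = coboundary_set p X G"
        using subgroup.mem_carrier[OF BX fu] BX fu by (rule h.H.coset_join2)
      have 2: "coboundary_set p X G #>\<^bsub>cocycle_group p X G\<^esub> cochain_map p X f ?e = coboundary_set p X G"
        unfolding h.hom_one by (rule h.H.coset_mult_one[OF subgroup.subset[OF BX]])
      have "coboundary_set p Y G #>\<^bsub>cocycle_group p Y G\<^esub> u =
            coboundary_set p Y G #>\<^bsub>cocycle_group p Y G\<^esub> ?e"
      proof (rule inj_onD[OF L])
        show "cohomology_induced p X G f (coboundary_set p Y G #>\<^bsub>cocycle_group p Y G\<^esub> u) =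
              cohomology_induced p X G f (coboundary_set p Y G #>\<^bsub>cocycle_group p Y G\<^esub> ?e)"
          unfolding cohomology_induced_coset[OF f u] cohomology_induced_coset[OF f e] 1 2 by (rule refl)
      qed (unfold carr, (rule imageI, rule u e)+)
      also have "\<dots> = coboundary_set p Y G"
        by (rule h.G.coset_mult_one[OF subgroup.subset[OF BY]])
      finally show "u \<in> coboundary_set p Y G"
        by (rule mem[OF u])
    qed
  next
    assume R: ?R
    show ?L
    proof (rule inj_onI)
      fix K L assume KL: "K \<in> carrier (cohomology_group p Y G)" "L \<in> carrier (cohomology_group p Y G)"
        "cohomology_induced p X G f K = cohomology_induced p X G f L"
      obtain u v where uv: "u \<in> cocycle_set p Y G" "v \<in> cocycle_set p Y G"
        "K = coboundary_set p Y G #>\<^bsub>cocycle_group p Y G\<^esub> u"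
        "L = coboundary_set p Y G #>\<^bsub>cocycle_group p Y G\<^esub> v"
        using KL(1,2) by (auto simp: carr)
      define w where "w = u \<otimes>\<^bsub>cocycle_group p Y G\<^esub> inv\<^bsub>cocycle_group p Y G\<^esub> v"
      have w: "w \<in> cocycle_set p Y G"
        using h.G.m_closed[OF _ h.G.inv_closed, of u v] uv(1,2) unfolding cY w_def by blast
      have "coboundary_set p X G #>\<^bsub>cocycle_group p X G\<^esub> cochain_map p X f u =
            coboundary_set p X G #>\<^bsub>cocycle_group p X G\<^esub> cochain_map p X f v"
        using KL(3) unfolding uv(3,4) cohomology_induced_coset[OF f uv(1)] cohomology_induced_coset[OF f uv(2)] .
      then have "cochain_map p X f u \<otimes>\<^bsub>cocycle_group p X G\<^esub> inv\<^bsub>cocycle_group p X G\<^esub> cochain_map p X f v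
          \<in> coboundary_set p X G"
        using subgroup.rcos_module[OF BX h.H.is_group, of "cochain_map p X f v" "cochain_map p X f u"]
          h.H.rcos_self[OF _ BX, of "cochain_map p X f u"] cochain_map_cocycle[OF f uv(1)]
          cochain_map_cocycle[OF f uv(2)]
        unfolding cX by metis
      then have "cochain_map p X f w \<in> coboundary_set p X G"
        using h.hom_mult[OF _ h.G.inv_closed, of u v] h.hom_inv[of v] uv(1,2) unfolding cY w_def by metis
      then have "w \<in> coboundary_set p Y G"
        using R w by blast
      then have "u \<in> coboundary_set p Y G #>\<^bsub>cocycle_group p Y G\<^esub> v"
        using subgroup.rcos_module[OF BY h.G.is_group, of v u] uv(1,2) unfolding cY w_def by blast
      then show "K = L"
        using h.G.repr_independence[OF _ _ BY, of u v] uv unfolding cY by metis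
    qed
  qed
qed

end

text \<open>Quantifying over the abelian groups whose elements are singular chains loses no generality:
  injectivity for those coefficients implies injectivity for abelian groups over any type, since
  only the subgroup generated by the values of one cocycle and one cochain matters.\<close>

lemma infinite_chain_type: "infinite (UNIV :: 'a chain set)"
proof -
  have "inj (\<lambda>n::int. Poly_Mapping.single (undefined :: (nat \<Rightarrow> real) \<Rightarrow> 'a) n)"
    by (rule injI) (metis lookup_single_eq)
  then show ?thesis
    using infinite_UNIV_int finite_subset[OF subset_UNIV] finite_imageD by blast
qed

proposition inj_cohomology_induced_any_type:
  fixes X Y :: "'a topology" and H :: "('g, 'm) monoid_scheme"
  assumes f: "continuous_map X Y f"
    and inj: "\<And>G :: 'a chain monoid. comm_group G \<Longrightarrow>
      inj_on (cohomology_induced (Suc p) X G f) (carrier (cohomology_group (Suc p) Y G))"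
    and H: "comm_group H"
  shows "inj_on (cohomology_induced (Suc p) X H f) (carrier (cohomology_group (Suc p) Y H))"
  unfolding inj_cohomology_induced_iff[OF H f]
proof (intro ballI impI)
  fix u assume u: "u \<in> cocycle_set (Suc p) Y H"
    and fu: "cochain_map (Suc p) X f u \<in> coboundary_set (Suc p) X H"
  interpret H: comm_group H by (rule H)
  have uc: "u \<in> carrier (cochain_group (Suc p) Y H)"
    using u by (simp add: cocycle_set_def kernel_def)
  obtain w where w: "w \<in> carrier (cochain_group p X H)"
    and uw: "cochain_map (Suc p) X f u = cochain_coboundary p X w"
    using fu by (auto simp: coboundary_set_def)
  note uD = uc[unfolded carrier_cochain_group[OF H]] and wD = w[unfolded carrier_cochain_group[OF H]]
  interpret u: group_hom "chain_group (Suc p) Y" H u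
    by (rule cochain_hom[OF H uc])
  interpret w: group_hom "chain_group p X" H w
    by (rule cochain_hom[OF H w])
  define S where "S = (\<lambda>(c,d). u c \<otimes>\<^bsub>H\<^esub> w d) ` (singular_chain_set (Suc p) Y \<times> singular_chain_set p X)"
  have S: "subgroup S H"
  proof -
    have "subgroup (u ` carrier (chain_group (Suc p) Y) <#>\<^bsub>H\<^esub> w ` carrier (chain_group p X)) H"
      using u.img_is_subgroup w.img_is_subgroup H.mult_subgroups by blast
    moreover have "u ` carrier (chain_group (Suc p) Y) <#>\<^bsub>H\<^esub> w ` carrier (chain_group p X) = S"
      by (auto simp: S_def set_mult_def)
    ultimately show ?thesis by simp
  qed
  have uS: "u c \<in> S" if "singular_chain (Suc p) Y c" for c
  proof -
    have "u c = u c \<otimes>\<^bsub>H\<^esub> w 0"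
      using that uD w.hom_one by simp
    then show ?thesis
      using that unfolding S_def by (auto intro!: rev_image_eqI[of "(c, 0)"])
  qed
  have wS: "w c \<in> S" if "singular_chain p X c" for c
  proof -
    have "w c = u 0 \<otimes>\<^bsub>H\<^esub> w c"
      using that wD u.hom_one by simp
    then show ?thesis
      using that unfolding S_def by (auto intro!: rev_image_eqI[of "(0, c)"])
  qed
  obtain e :: "'g \<Rightarrow> 'a chain" where e: "inj_on e S"
  proof -
    let ?g = "\<lambda>(c,d). u c \<otimes>\<^bsub>H\<^esub> w d"
    let ?D = "singular_chain_set (Suc p) Y \<times> singular_chain_set p X"
    obtain b :: "'a chain \<times> 'a chain \<Rightarrow> 'a chain" where b: "bij_betw b (UNIV \<times> UNIV) UNIV"
      using card_of_Times_same_infinite[OF infinite_chain_type[where 'a='a]] card_of_ordIso by blast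
    have "inj_on (b \<circ> inv_into ?D ?g) S"
      by (intro comp_inj_on) (auto simp: S_def inj_on_inv_into intro: inj_on_subset[OF bij_betw_imp_inj_on[OF b]])
    then show ?thesis
      using that by blast
  qed
  define r where "r = inv_into S e"
  have re: "r (e x) = x" if "x \<in> S" for x
    using that e by (simp add: r_def)
  note Scl = subgroup.m_closed[OF S] subgroup.one_closed[OF S] subgroup.m_inv_closed[OF S]
  define G :: "'a chain monoid" where
    "G = \<lparr>carrier = e ` S, monoid.mult = (\<lambda>x y. e (r x \<otimes>\<^bsub>H\<^esub> r y)), one = e \<one>\<^bsub>H\<^esub>\<rparr>"
  have G: "comm_group G"
  proof (rule comm_groupI)
    fix x assume "x \<in> carrier G"
    then obtain s where "s \<in> S" "x = e s" by (auto simp: G_def)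
    then show "\<exists>y\<in>carrier G. y \<otimes>\<^bsub>G\<^esub> x = \<one>\<^bsub>G\<^esub>"
      using subgroup.mem_carrier[OF S] by (auto simp: G_def re Scl intro!: bexI[of _ "inv\<^bsub>H\<^esub> s"])
  qed (use subgroup.mem_carrier[OF S] in \<open>auto simp: G_def re Scl H.m_ac\<close>)
  have eG: "e x \<in> carrier G" if "x \<in> S" for x
    using that by (simp add: G_def)
  have e_mult: "e (x \<otimes>\<^bsub>H\<^esub> y) = e x \<otimes>\<^bsub>G\<^esub> e y" if "x \<in> S" "y \<in> S" for x y
    using that by (simp add: G_def re)
  define u' where "u' = (\<lambda>c\<in>singular_chain_set (Suc p) Y. e (u c))"
  define w' where "w' = (\<lambda>c\<in>singular_chain_set p X. e (w c))"
  have u'c: "u' \<in> carrier (cochain_group (Suc p) Y G)"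
    using uD by (auto simp: carrier_cochain_group[OF G] u'_def eG uS singular_chain_add e_mult)
  have w'c: "w' \<in> carrier (cochain_group p X G)"
    using wD by (auto simp: carrier_cochain_group[OF G] w'_def eG wS singular_chain_add e_mult)
  have bd: "singular_chain (Suc q) Z c \<Longrightarrow> singular_chain q Z (chain_boundary (Suc q) c)"
    for q c and Z :: "'a topology"
    using singular_chain_boundary[of "Suc q" Z c] by simp
  have "cochain_coboundary (Suc p) Y u' = \<one>\<^bsub>cochain_group (Suc (Suc p)) Y G\<^esub>"
  proof -
    have "u (chain_boundary (Suc (Suc p)) c) = \<one>\<^bsub>H\<^esub>" if "singular_chain (Suc (Suc p)) Y c" for c
    proof -
      have "cochain_coboundary (Suc p) Y u c = \<one>\<^bsub>cochain_group (Suc (Suc p)) Y H\<^esub> c"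
        using u by (simp add: cocycle_set_def kernel_def)
      then show ?thesis
        using that by (simp add: cochain_coboundary_def cochain_group_def)
    qed
    then show ?thesis
      using bd by (auto simp: cochain_coboundary_def cochain_group_def u'_def G_def)
  qed
  then have u': "u' \<in> cocycle_set (Suc p) Y G"
    using u'c by (simp add: cocycle_set_def kernel_def)
  have "cochain_map (Suc p) X f u' = cochain_coboundary p X w'"
  proof
    fix c
    show "cochain_map (Suc p) X f u' c = cochain_coboundary p X w' c"
      using fun_cong[OF uw, of c] bd singular_chain_chain_map[OF _ f, of "Suc p" c]
      by (auto simp: cochain_map_def cochain_coboundary_def u'_def w'_def)
  qed
  then have "cochain_map (Suc p) X f u' \<in> coboundary_set (Suc p) X G"
    using w'c by (auto simp: coboundary_set_def)
  then have "u' \<in> coboundary_set (Suc p) Y G"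
    using inj[OF G] u' unfolding inj_cohomology_induced_iff[OF G f] by blast
  then obtain v' where v': "v' \<in> carrier (cochain_group p Y G)" "u' = cochain_coboundary p Y v'"
    by (auto simp: coboundary_set_def)
  define v where "v = (\<lambda>c\<in>singular_chain_set p Y. r (v' c))"
  note v'D = v'(1)[unfolded carrier_cochain_group[OF G]]
  have v'S: "\<exists>s\<in>S. v' c = e s" if "singular_chain p Y c" for c
    using v'D that by (auto simp: G_def)
  have r_mult: "r (x \<otimes>\<^bsub>G\<^esub> y) = r x \<otimes>\<^bsub>H\<^esub> r y" if "x \<in> carrier G" "y \<in> carrier G" for x y
    using that by (auto simp: G_def re Scl)
  have "v \<in> carrier (cochain_group p Y H)"
    unfolding carrier_cochain_group[OF H]
    using v'S v'D re subgroup.mem_carrier[OF S]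
    by (fastforce simp: v_def singular_chain_add r_mult)
  moreover have "u = cochain_coboundary p Y v"
  proof (rule extensionalityI[of _ "singular_chain_set (Suc p) Y"])
    fix c assume c: "c \<in> singular_chain_set (Suc p) Y"
    have "e (u c) = v' (chain_boundary (Suc p) c)"
      using fun_cong[OF v'(2), of c] c by (simp add: u'_def cochain_coboundary_def)
    then have "u c = r (v' (chain_boundary (Suc p) c))"
      using re[OF uS, of c] c by simp
    then show "u c = cochain_coboundary p Y v c"
      using c bd by (simp add: cochain_coboundary_def v_def)
  qed (use uD in \<open>auto simp: cochain_coboundary_def\<close>)
  ultimately show "u \<in> coboundary_set (Suc p) Y H"
    by (auto simp: coboundary_set_def)
qed

end

theory Submission
  imports Defs
begin

text \<open>Write \<open>Y = \<pi>(M)\<close> and let \<open>H \<subseteq> \<pi>\<^sub>1(Y)\<close> be the image of \<open>\<pi>\<^sub>1(M)\<close>. A covering map with path connected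
  total space is injective as soon as \<open>H = \<pi>\<^sub>1(Y)\<close>, and since \<open>\<pi>\<^sub>1(Y)\<close> is nilpotent it suffices that every
  normal subgroup \<open>N \<supseteq> H\<close> with abelian quotient is all of \<open>\<pi>\<^sub>1(Y)\<close>. The projection \<open>\<pi>\<^sub>1(Y) \<rightarrow> \<pi>\<^sub>1(Y)/N\<close>
  is a class in \<open>H\<^sup>1(Y; \<pi>\<^sub>1(Y)/N)\<close>. Loops in \<open>\<Omega>\<close> lift to \<open>M\<close> through \<open>\<alpha>\<close>, so the class vanishes on \<open>\<Omega>\<close>,
  hence on \<open>Y\<close> by injectivity of \<open>i\<^sup>*\<close>, which means \<open>N = \<pi>\<^sub>1(Y)\<close>.\<close>

section \<open>Subgroups of nilpotent groups\<close>

text \<open>\<open>H\<close> need not be normal, so the cosets of \<open>H\<close> need not form a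
  group, and first cohomology sees only abelian quotients anyway. Nilpotency closes this gap: a
  proper subgroup of a nilpotent group always lies in a proper normal subgroup with abelian
  quotient. To turn the projection to the quotient by \<open>N\<close> into an actual cocycle, every
  point of Y needs a chosen path from the base point. Taking these as projections of paths in M that
  end, over \<Omega>, at the values of \<alpha> makes the cocycle pulled back to \<Omega>
  identically trivial. A loop, viewed as a singular 1-simplex, has boundary zero, so every
  coboundary is trivial on it; this is how vanishing of the class on Y forces \<open>N\<close> to be
  everything. The quotient group consists of sets of path classes, whereas the hypothesis on
  cohomology speaks of groups of singular chains; \<open>inj_cohomology_induced_any_type\<close>
  carries it across.\<close>

text \<open>Modulo \<open>P\<close> the elements of \<open>H\<close> vanish and those of
  \<open>K\<close> are central, so a quotient generated by the images of \<open>H\<close> and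
  \<open>K\<close> is abelian. Normality of \<open>P\<close> has to come first, and is itself
  checked on the generators.\<close>

lemma (in group) generate_normalized:
  assumes K: "K \<subseteq> carrier G"
    and gen: "generate G (H \<union> K) = carrier G" and H: "H \<subseteq> P" and P: "subgroup P G"
    and KP: "\<And>k g. k \<in> K \<Longrightarrow> g \<in> carrier G \<Longrightarrow> k \<otimes> g \<otimes> inv k \<otimes> inv g \<in> P"
  shows "P \<lhd> G"
    and "\<And>x y. x \<in> carrier G \<Longrightarrow> y \<in> carrier G \<Longrightarrow> x \<otimes> y \<otimes> inv x \<otimes> inv y \<in> P"
proof -
  note PG = subgroup.mem_carrier[OF P] and Pcl = subgroup.m_closed[OF P] subgroup.m_inv_closed[OF P]
  have KG: "k \<in> K \<Longrightarrow> k \<in> carrier G" for k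
    using K by blast
  have cancel: "inv a \<otimes> (a \<otimes> b) = b" "a \<otimes> (inv a \<otimes> b) = b" if "a \<in> carrier G" "b \<in> carrier G" for a b
    using that by (simp_all flip: m_assoc)
  \<comment> \<open>Conjugation in both directions is recorded: for infinite \<open>P\<close>, being
    mapped into itself by \<open>g\<close> does not give the same for \<open>inv g\<close>. With
    both, closure of \<open>D\<close> under inverses is immediate.\<close>
  define D where "D = {g \<in> carrier G. \<forall>p\<in>P. g \<otimes> p \<otimes> inv g \<in> P \<and> inv g \<otimes> p \<otimes> g \<in> P}"
  have KD: "k \<otimes> p \<otimes> inv k \<in> P" "inv k \<otimes> p \<otimes> k \<in> P" if k: "k \<in> K" and p: "p \<in> P" for k p
  proof -
    have "k \<otimes> p \<otimes> inv k = (k \<otimes> p \<otimes> inv k \<otimes> inv p) \<otimes> p"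
      using KG[OF k] PG[OF p] by (simp add: m_assoc)
    then show "k \<otimes> p \<otimes> inv k \<in> P"
      using Pcl(1)[OF KP[OF k PG[OF p]] p] by simp
    \<comment> \<open>The commutator of \<open>k\<close> with the conjugate
      \<open>inv k \<otimes> p \<otimes> k\<close> is \<open>p\<close> times the inverse of that
      conjugate. \<open>KP\<close> is thus applied to an element not yet known to lie in
      \<open>P\<close>, which is why it ranges over all of \<open>G\<close>.\<close>
    have "inv k \<otimes> p \<otimes> k = (inv (k \<otimes> (inv k \<otimes> p \<otimes> k) \<otimes> inv k \<otimes> inv (inv k \<otimes> p \<otimes> k))) \<otimes> p"
      using KG[OF k] PG[OF p] by (simp add: m_assoc inv_mult_group cancel)
    then show "inv k \<otimes> p \<otimes> k \<in> P"
      using Pcl(1)[OF Pcl(2)[OF KP[OF k, of "inv k \<otimes> p \<otimes> k"]] p] KG[OF k] PG[OF p] by simp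
  qed
  have HKD: "h \<in> D" if "h \<in> H \<union> K" for h
    using that KD KG H PG Pcl by (auto simp: D_def subset_iff)
  have D: "g \<in> D" if "g \<in> generate G (H \<union> K)" for g
    using that
  proof induction
    case (inv h)
    then show ?case using HKD[OF inv] by (auto simp: D_def)
  next
    case (eng g h)
    have "g \<otimes> h \<otimes> p \<otimes> inv (g \<otimes> h) = g \<otimes> (h \<otimes> p \<otimes> inv h) \<otimes> inv g"
      "inv (g \<otimes> h) \<otimes> p \<otimes> (g \<otimes> h) = inv h \<otimes> (inv g \<otimes> p \<otimes> g) \<otimes> h" if "p \<in> P" for p
      using eng PG[OF that] by (auto simp: D_def m_assoc inv_mult_group)
    then show ?case using eng by (auto simp: D_def)
  qed (use HKD PG in \<open>auto simp: D_def\<close>)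
  show N: "P \<lhd> G"
    unfolding normal_inv_iff using P D gen by (auto simp: D_def)
  \<comment> \<open>Closure of \<open>C\<close> under products and inverses rests on [gh,x] = g
    [h,x] g^-1 [g,x] and [h^-1,x] = h^-1 [h,x]^-1 h. The conjugations stay in \<open>P\<close> only
    because \<open>P\<close> is already known to be normal.\<close>
  define C where "C = {g \<in> carrier G. \<forall>x\<in>carrier G. g \<otimes> x \<otimes> inv g \<otimes> inv x \<in> P}"
  have cj: "x \<otimes> p \<otimes> inv x \<in> P" if "p \<in> P" "x \<in> carrier G" for p x
    using N that by (simp add: normal_inv_iff)
  have HKC: "h \<in> C" if hHK: "h \<in> H \<union> K" for h
    using hHK
  proof
    assume "h \<in> H"
    then have h: "h \<in> P" using H by blast
    have "h \<otimes> x \<otimes> inv h \<otimes> inv x = h \<otimes> (x \<otimes> inv h \<otimes> inv x)" if "x \<in> carrier G" for x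
      using PG[OF h] that by (simp add: m_assoc)
    then show ?thesis
      using h PG Pcl cj by (auto simp: C_def)
  qed (use KG KP in \<open>auto simp: C_def\<close>)
  have C: "g \<in> C" if "g \<in> generate G (H \<union> K)" for g
    using that
  proof induction
    case (inv h)
    have h: "h \<in> carrier G" "\<And>x. x \<in> carrier G \<Longrightarrow> h \<otimes> x \<otimes> inv h \<otimes> inv x \<in> P"
      using HKC[OF inv] by (auto simp: C_def)
    have "inv h \<otimes> x \<otimes> inv (inv h) \<otimes> inv x = inv h \<otimes> inv (h \<otimes> x \<otimes> inv h \<otimes> inv x) \<otimes> inv (inv h)"
      if "x \<in> carrier G" for x
      using h(1) that by (simp add: m_assoc inv_mult_group cancel)
    then show ?case
      using h(1) cj[OF Pcl(2)[OF h(2)] inv_closed[OF h(1)]] by (auto simp: C_def)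
  next
    case (eng g h)
    have "g \<otimes> h \<otimes> x \<otimes> inv (g \<otimes> h) \<otimes> inv x =
        (g \<otimes> (h \<otimes> x \<otimes> inv h \<otimes> inv x) \<otimes> inv g) \<otimes> (g \<otimes> x \<otimes> inv g \<otimes> inv x)" if "x \<in> carrier G" for x
      using eng that by (auto simp: C_def m_assoc inv_mult_group cancel)
    then show ?case
      using eng Pcl cj by (auto simp: C_def)
  qed (use HKC in \<open>auto simp: C_def subgroup.one_closed[OF P]\<close>)
  show "x \<otimes> y \<otimes> inv x \<otimes> inv y \<in> P" if "x \<in> carrier G" "y \<in> carrier G" for x y
    using C[of x] that gen by (auto simp: C_def)
qed

lemma (in group) lower_central_series_subset: "lower_central_series G k \<subseteq> carrier G"
proof (induction k)
  case (Suc k)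
  show ?case
    unfolding lower_central_series.simps
    by (rule generate_incl) (use Suc in auto)
qed simp

text \<open>By induction on k, \<open>G\<close> is generated by \<open>H\<close> and the k-th term
  of the lower central series; once that term is trivial, \<open>H\<close> is everything. In the
  step, let \<open>P\<close> be generated by \<open>H\<close> and the next term. The current term is
  central modulo \<open>P\<close>, so \<open>P\<close> is normal with abelian quotient and
  \<open>ab\<close> applies to it.\<close>

lemma nilpotent_group_eq_subgroupI:
  fixes G (structure)
  assumes nil: "nilpotent_group G" and H: "subgroup H G"
    and ab: "\<And>N. N \<lhd> G \<Longrightarrow> comm_group (G Mod N) \<Longrightarrow> H \<subseteq> N \<Longrightarrow> N = carrier G"
  shows "H = carrier G"
proof -
  interpret group G
    using nil by (simp add: nilpotent_group_def)
  note HG = subgroup.subset[OF H]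
  have gen: "generate G (H \<union> lower_central_series G k) = carrier G" for k
  proof (induction k)
    case 0
    show ?case
      using generate_incl[of "H \<union> carrier G"] generate.incl[of _ "H \<union> carrier G"] HG by auto
  next
    case (Suc k)
    define P where "P = generate G (H \<union> lower_central_series G (Suc k))"
    have P: "subgroup P G"
      unfolding P_def by (intro generate_is_subgroup Un_least HG lower_central_series_subset)
    have HP: "H \<subseteq> P"
      by (auto simp: P_def intro: generate.incl)
    have KP: "k' \<otimes> g \<otimes> inv k' \<otimes> inv g \<in> P" if "k' \<in> lower_central_series G k" "g \<in> carrier G" for k' g
      using that unfolding P_def by (auto intro!: generate.incl)
    have N: "P \<lhd> G"
      by (rule generate_normalized(1)[OF lower_central_series_subset Suc HP P]) (rule KP)
    have comm: "x \<otimes> y \<otimes> inv x \<otimes> inv y \<in> P" if "x \<in> carrier G" "y \<in> carrier G" for x y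
      by (rule generate_normalized(2)[OF lower_central_series_subset Suc HP P _ that]) (rule KP)
    interpret normal P G by (rule N)
    have "comm_group (G Mod P)"
    proof (rule group.group_comm_groupI[OF factorgroup_is_group])
      fix U V assume "U \<in> carrier (G Mod P)" "V \<in> carrier (G Mod P)"
      then obtain x y where xy: "x \<in> carrier G" "y \<in> carrier G" "U = P #> x" "V = P #> y"
        by (auto simp: carrier_FactGroup)
      have "x \<otimes> y \<otimes> inv (y \<otimes> x) \<in> P"
        using comm[OF xy(1,2)] xy(1,2) by (simp add: inv_mult_group m_assoc)
      then have "x \<otimes> y \<in> P #> (y \<otimes> x)"
        using rcos_module_rev[OF is_group] xy(1,2) by simp
      then have "P #> (y \<otimes> x) = P #> (x \<otimes> y)"
        using repr_independence[OF _ _ P] xy(1,2) by simp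
      then show "U \<otimes>\<^bsub>G Mod P\<^esub> V = V \<otimes>\<^bsub>G Mod P\<^esub> U"
        using xy by (simp add: rcos_sum)
    qed
    then have "P = carrier G"
      by (rule ab[OF N _ HP])
    then show ?case
      unfolding P_def .
  qed
  obtain k where "lower_central_series G k = {\<one>}"
    using nil by (auto simp: nilpotent_group_def)
  then have "generate G H = carrier G"
    using gen[of k] subgroup.one_closed[OF H] by (simp add: insert_absorb)
  then show ?thesis
    using generate_subgroup_incl[OF subset_refl H] HG by auto
qed

section \<open>Path lifting\<close>

text \<open>The covering space theory of the library assumes that the total space lies in a normed
  vector space. For paths, the following versions by interval bisection need no such assumption.\<close>

lemma covering_space_sheet:
  assumes "covering_space C p S" "x \<in> C"
  obtains T U q where "x \<in> U" "openin (top_of_set C) U" "openin (top_of_set S) T" "homeomorphism U T p q"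
    and "\<And>y. y \<in> C \<Longrightarrow> p y \<in> T \<Longrightarrow>
      \<exists>V. y \<in> V \<and> openin (top_of_set C) V \<and> inj_on p V \<and> (V = U \<or> disjnt V U)"
proof -
  have "p x \<in> S"
    using assms by (auto simp: covering_space_def)
  then obtain T \<V> where T: "p x \<in> T" "openin (top_of_set S) T" and \<V>: "\<Union>\<V> = C \<inter> p -` T"
    "\<And>U. U \<in> \<V> \<Longrightarrow> openin (top_of_set C) U" "pairwise disjnt \<V>"
    "\<And>U. U \<in> \<V> \<Longrightarrow> \<exists>q. homeomorphism U T p q"
    using assms(1) unfolding covering_space_def by meson
  obtain U where U: "U \<in> \<V>" "x \<in> U"
    using \<V>(1) T(1) assms(2) by blast
  obtain q where q: "homeomorphism U T p q"
    using \<V>(4) U(1) by blast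
  show thesis
  proof (rule that[OF U(2) \<V>(2)[OF U(1)] T(2) q])
    fix y assume "y \<in> C" "p y \<in> T"
    then obtain V where V: "V \<in> \<V>" "y \<in> V"
      using \<V>(1) by blast
    moreover have "inj_on p V"
      using \<V>(4)[OF V(1)] by (metis homeomorphism_def inj_on_inverseI)
    moreover have "V = U \<or> disjnt V U"
      using \<V>(3) U(1) V(1) by (auto simp: pairwise_def)
    ultimately show "\<exists>V. y \<in> V \<and> openin (top_of_set C) V \<and> inj_on p V \<and> (V = U \<or> disjnt V U)"
      using \<V>(2) by blast
  qed
qed

lemma continuous_on_real_openin_nhd:
  fixes f :: "real \<Rightarrow> 'a::topological_space"
  assumes f: "continuous_on J f" "f ` J \<subseteq> C" and U: "openin (top_of_set C) U" and x: "x \<in> J" "f x \<in> U"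
  obtains d where "d > 0" "\<And>t. t \<in> J \<Longrightarrow> \<bar>t - x\<bar> < d \<Longrightarrow> f t \<in> U"
proof -
  have "openin (top_of_set J) (J \<inter> f -` U)"
    using continuous_openin_preimage[OF f(1) _ U] f(2) by blast
  then obtain d where "d > 0" "\<And>t. t \<in> J \<Longrightarrow> dist t x < d \<Longrightarrow> t \<in> J \<inter> f -` U"
    using x unfolding openin_euclidean_subtopology_iff by blast
  then show thesis
    using that by (auto simp: dist_real_def)
qed

text \<open>The property fed to interval bisection is that agreement at s propagates to t. Near each
  point, g stays in one sheet and h in one sheet over the same open set; sheets are equal or
  disjoint, so agreement at s makes them equal, and p is injective on a sheet. No separation axiom
  for the total space is involved.\<close>

lemma covering_space_path_lift_unique:
  fixes a b :: real
  assumes cov: "covering_space C p S" and ab: "a \<le> b"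
    and g: "continuous_on {a..b} g" "g ` {a..b} \<subseteq> C"
    and h: "continuous_on {a..b} h" "h ` {a..b} \<subseteq> C"
    and eq: "\<And>t. t \<in> {a..b} \<Longrightarrow> p (g t) = p (h t)" and start: "g a = h a"
  shows "g b = h b"
proof -
  define P where "P s t \<longleftrightarrow> a \<le> s \<and> s \<le> t \<and> t \<le> b \<longrightarrow> g s = h s \<longrightarrow> g t = h t" for s t
  have "P a b"
    using ab
  proof (induction rule: Bolzano)
    case (trans s t u)
    then show ?case by (auto simp: P_def)
  next
    case (local x)
    then have x: "x \<in> {a..b}" by simp
    then have "g x \<in> C" "h x \<in> C" "p (h x) = p (g x)"
      using g h eq by auto
    obtain T U q where U: "g x \<in> U" "openin (top_of_set C) U" "homeomorphism U T p q"
      and V: "\<And>y. y \<in> C \<Longrightarrow> p y \<in> T \<Longrightarrow>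
        \<exists>V. y \<in> V \<and> openin (top_of_set C) V \<and> inj_on p V \<and> (V = U \<or> disjnt V U)"
      using covering_space_sheet[OF cov \<open>g x \<in> C\<close>] by metis
    have "p (h x) \<in> T"
      using U \<open>p (h x) = p (g x)\<close> by (auto simp: homeomorphism_def)
    then obtain V where V: "h x \<in> V" "openin (top_of_set C) V" "inj_on p V" "V = U \<or> disjnt V U"
      using V \<open>h x \<in> C\<close> by blast
    obtain d where d: "d > 0" "\<And>t. t \<in> {a..b} \<Longrightarrow> \<bar>t - x\<bar> < d \<Longrightarrow> g t \<in> U"
      using continuous_on_real_openin_nhd[OF g U(2) x U(1)] by metis
    obtain e where e: "e > 0" "\<And>t. t \<in> {a..b} \<Longrightarrow> \<bar>t - x\<bar> < e \<Longrightarrow> h t \<in> V"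
      using continuous_on_real_openin_nhd[OF h V(2) x V(1)] by metis
    have "P s t" if st: "s \<le> x" "x \<le> t" "t - s < min d e" for s t
      unfolding P_def
    proof clarify
      assume "a \<le> s" "t \<le> b" "g s = h s" "s \<le> t"
      then have *: "g s \<in> U" "g t \<in> U" "p (g t) = p (h t)"
        and **: "h s \<in> V" "h t \<in> V"
        using d(2)[of s] d(2)[of t] e(2)[of s] e(2)[of t] st eq by auto
      then have "U = V"
        using \<open>g s = h s\<close> V(4) by (auto simp: disjnt_def)
      then show "g t = h t"
        using V(3) * ** by (auto dest: inj_onD)
    qed
    then show ?case
      using d(1) e(1) by (intro exI[of _ "min d e"]) auto
  qed
  then show ?thesis
    using ab start by (simp add: P_def)
qed

lemma covering_space_path_lift_exists:
  fixes a b :: real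
  assumes cov: "covering_space C p S" and ab: "a \<le> b"
    and f: "continuous_on {a..b} f" "f ` {a..b} \<subseteq> S" and m: "m \<in> C" "p m = f a"
  obtains h where "continuous_on {a..b} h" "h ` {a..b} \<subseteq> C" "h a = m"
    "\<And>t. t \<in> {a..b} \<Longrightarrow> p (h t) = f t"
proof -
  \<comment> \<open>Lifts are demanded from every point over \<open>f s\<close>, since the lift on
    the second of two adjacent intervals must start wherever the first one ended.\<close>
  define P where "P s t \<longleftrightarrow> (a \<le> s \<and> s \<le> t \<and> t \<le> b \<longrightarrow> (\<forall>m\<in>C. p m = f s \<longrightarrow>
      (\<exists>h. continuous_on {s..t} h \<and> h ` {s..t} \<subseteq> C \<and> h s = m \<and> (\<forall>r\<in>{s..t}. p (h r) = f r))))" for s t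
  have "P a b"
    using ab
  proof (induction rule: Bolzano)
    case (trans s t u)
    show ?case
      unfolding P_def
    proof clarify
      fix m assume *: "a \<le> s" "s \<le> u" "u \<le> b" "m \<in> C" "p m = f s"
      obtain h where h: "continuous_on {s..t} h" "h ` {s..t} \<subseteq> C" "h s = m" "\<forall>r\<in>{s..t}. p (h r) = f r"
        using trans * unfolding P_def by auto
      have "h t \<in> C" "p (h t) = f t"
        using h trans by auto
      then obtain k where k: "continuous_on {t..u} k" "k ` {t..u} \<subseteq> C" "k t = h t" "\<forall>r\<in>{t..u}. p (k r) = f r"
        using trans * unfolding P_def by auto
      have "continuous_on ({s..t} \<union> {t..u}) (\<lambda>r. if r \<le> t then h r else k r)"
        using h k by (intro continuous_on_cases) auto
      moreover have "{s..t} \<union> {t..u} = {s..u}"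
        using trans by auto
      ultimately have "continuous_on {s..u} (\<lambda>r. if r \<le> t then h r else k r)"
        by simp
      then show "\<exists>h. continuous_on {s..u} h \<and> h ` {s..u} \<subseteq> C \<and> h s = m \<and> (\<forall>r\<in>{s..u}. p (h r) = f r)"
        using h k trans by (intro exI[of _ "\<lambda>r. if r \<le> t then h r else k r"]) auto
    qed
  next
    case (local x)
    then have x: "x \<in> {a..b}" by simp
    then have "f x \<in> S"
      using f by auto
    then obtain T \<V> where T: "f x \<in> T" "openin (top_of_set S) T" and \<V>: "\<Union>\<V> = C \<inter> p -` T"
      "\<And>U. U \<in> \<V> \<Longrightarrow> \<exists>q. homeomorphism U T p q"
      using cov unfolding covering_space_def by meson
    obtain d where d: "d > 0" "\<And>t. t \<in> {a..b} \<Longrightarrow> \<bar>t - x\<bar> < d \<Longrightarrow> f t \<in> T"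
      using continuous_on_real_openin_nhd[OF f T(2) x T(1)] by metis
    have "P s t" if st: "s \<le> x" "x \<le> t" "t - s < d" for s t
      unfolding P_def
    proof clarify
      fix m assume *: "a \<le> s" "t \<le> b" "m \<in> C" "p m = f s" "s \<le> t"
      have fT: "f r \<in> T" if "r \<in> {s..t}" for r
        using d st * that by auto
      have "p m \<in> T"
        using fT[of s] * by simp
      then obtain U where U: "U \<in> \<V>" "m \<in> U"
        using \<V>(1) \<open>m \<in> C\<close> by blast
      obtain q where q: "homeomorphism U T p q"
        using \<V>(2) U(1) by blast
      have "continuous_on {s..t} (q \<circ> f)"
      proof (rule continuous_on_compose)
        show "continuous_on {s..t} f"
          using f(1) * by (auto intro: continuous_on_subset)
        show "continuous_on (f ` {s..t}) q"
          using q fT by (auto simp: homeomorphism_def intro: continuous_on_subset)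
      qed
      moreover have "(q \<circ> f) ` {s..t} \<subseteq> C"
      proof -
        have "q (f r) \<in> U" if "r \<in> {s..t}" for r
          using q fT[OF that] by (auto simp: homeomorphism_def)
        moreover have "U \<subseteq> C"
          using U(1) \<V>(1) by blast
        ultimately show ?thesis by auto
      qed
      moreover have "(q \<circ> f) s = m"
        using q U(2) * by (metis comp_apply homeomorphism_apply1)
      moreover have "\<forall>r\<in>{s..t}. p ((q \<circ> f) r) = f r"
        using q fT by (auto simp: homeomorphism_def)
      ultimately show "\<exists>h. continuous_on {s..t} h \<and> h ` {s..t} \<subseteq> C \<and> h s = m \<and> (\<forall>r\<in>{s..t}. p (h r) = f r)"
        by blast
    qed
    then show ?case
      using d(1) by (intro exI[of _ d]) auto
  qed
  then show thesis
    using ab m that unfolding P_def by blast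
qed

text \<open>Each slice of the homotopy is lifted separately, starting at \<open>g 0\<close>. The
  endpoint of the lifted slice lies over the fixed point \<open>p (g 1)\<close>, so once it depends
  continuously on the homotopy parameter, it is constant by uniqueness of lifts. Only continuity of
  endpoints is established, not that of a lift on the whole square.\<close>

lemma covering_space_path_monodromy:
  assumes cov: "covering_space C p S" and hom: "homotopic_paths S (p \<circ> g) (p \<circ> h)"
    and g: "path g" "path_image g \<subseteq> C" and h: "path h" "path_image h \<subseteq> C"
    and start: "pathstart g = pathstart h"
  shows "pathfinish g = pathfinish h"
proof -
  let ?I = "{0..1::real}"
  obtain K where K: "continuous_on (?I \<times> ?I) K" "K ` (?I \<times> ?I) \<subseteq> S"
    "\<And>t. t \<in> ?I \<Longrightarrow> K (0, t) = p (g t)" "\<And>t. t \<in> ?I \<Longrightarrow> K (1, t) = p (h t)"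
    "\<And>s. s \<in> ?I \<Longrightarrow> K (s, 0) = p (g 0)" "\<And>s. s \<in> ?I \<Longrightarrow> K (s, 1) = p (g 1)"
    using hom unfolding homotopic_paths by (auto simp: pathstart_def pathfinish_def image_subset_iff_funcset)
  have gC: "g t \<in> C" if "t \<in> ?I" for t
    using g(2) that by (auto simp: path_image_def)
  have Ks: "continuous_on ?I (\<lambda>t. K (s, t))" "(\<lambda>t. K (s, t)) ` ?I \<subseteq> S" if "s \<in> ?I" for s
    using that K(2) by (auto intro!: continuous_on_compose2[OF K(1)] continuous_intros)
  have "\<exists>l. continuous_on ?I l \<and> l ` ?I \<subseteq> C \<and> l 0 = g 0 \<and> (\<forall>t\<in>?I. p (l t) = K (s, t))" if "s \<in> ?I" for s
    using covering_space_path_lift_exists[OF cov zero_le_one Ks[OF that], of "g 0"] gC[of 0] K(5)[OF that]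
    by (metis atLeastAtMost_iff order_refl zero_le_one)
  then obtain l where l: "\<And>s. s \<in> ?I \<Longrightarrow> continuous_on ?I (l s)" "\<And>s. s \<in> ?I \<Longrightarrow> l s ` ?I \<subseteq> C"
    "\<And>s. s \<in> ?I \<Longrightarrow> l s 0 = g 0" "\<And>s t. s \<in> ?I \<Longrightarrow> t \<in> ?I \<Longrightarrow> p (l s t) = K (s, t)"
    by metis
  have lC: "l s t \<in> C" if "s \<in> ?I" "t \<in> ?I" for s t
    using l(2) that by blast
  have cont: "continuous_on ?I (\<lambda>s. l s 1)"
    unfolding continuous_on_def
  proof
    fix z assume z: "z \<in> ?I"
    \<comment> \<open>The parameter z is fixed and bisection runs along the path direction:
      continuity at z of the lifted slices at time u is passed on to time v, starting from time 0,
      where all slices agree.\<close>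
    define P where "P u v \<longleftrightarrow> 0 \<le> u \<and> u \<le> v \<and> v \<le> 1 \<longrightarrow>
        ((\<lambda>s. l s u) \<longlongrightarrow> l z u) (at z within ?I) \<longrightarrow> ((\<lambda>s. l s v) \<longlongrightarrow> l z v) (at z within ?I)" for u v
    have "P 0 1"
    proof (rule Bolzano)
      show "P u w" if "P u v" "P v w" "u \<le> v" "v \<le> w" for u v w
        using that by (auto simp: P_def)
      show "\<exists>d>0. \<forall>u v. u \<le> x \<and> x \<le> v \<and> v - u < d \<longrightarrow> P u v" if "0 \<le> x" "x \<le> 1" for x
      proof -
        have x: "x \<in> ?I" using that by simp
        obtain T U q where U: "l z x \<in> U" "openin (top_of_set C) U" "openin (top_of_set S) T" "homeomorphism U T p q"
          using covering_space_sheet[OF cov lC[OF z x]] by metis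
        have UC: "U \<subseteq> C" and qU: "\<And>y. y \<in> T \<Longrightarrow> q y \<in> U" "\<And>y. y \<in> T \<Longrightarrow> p (q y) = y" "\<And>y. y \<in> U \<Longrightarrow> q (p y) = y"
          "\<And>y. y \<in> U \<Longrightarrow> p y \<in> T" and contq: "continuous_on T q"
          using openin_imp_subset[OF U(2)] U(4) by (auto simp: homeomorphism_def)
        obtain d where d: "d > 0" "\<And>t. t \<in> ?I \<Longrightarrow> \<bar>t - x\<bar> < d \<Longrightarrow> l z t \<in> U"
          using continuous_on_real_openin_nhd[OF l(1,2)[OF z] U(2) x U(1)] by metis
        have "openin (top_of_set (?I \<times> ?I)) ((?I \<times> ?I) \<inter> K -` T)"
          using continuous_openin_preimage[OF K(1) _ U(3)] K(2) by blast
        moreover have "(z, x) \<in> (?I \<times> ?I) \<inter> K -` T"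
          using z x qU(4)[OF U(1)] l(4)[OF z x] by simp
        ultimately obtain e where e: "e > 0"
            "\<forall>y\<in>?I \<times> ?I. dist y (z, x) < e \<longrightarrow> y \<in> (?I \<times> ?I) \<inter> K -` T"
          unfolding openin_euclidean_subtopology_iff by meson
        have KT: "K (s, t) \<in> T" if "s \<in> ?I" "t \<in> ?I" "\<bar>s - z\<bar> < e/2" "\<bar>t - x\<bar> < e/2" for s t
        proof -
          have "dist (s, t) (z, x) \<le> \<bar>s - z\<bar> + \<bar>t - x\<bar>"
            unfolding dist_Pair_Pair dist_real_def by (rule sqrt_sum_squares_le_sum_abs[THEN order_trans]) simp
          then have "dist (s, t) (z, x) < e"
            using that by linarith
          then show ?thesis
            using e(2) that(1,2) by blast
        qed
        have "P u v" if uv: "u \<le> x" "x \<le> v" "v - u < min d (e/2)" for u v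
          unfolding P_def
        proof clarify
          assume uv': "0 \<le> u" "u \<le> v" "v \<le> 1" and lim: "((\<lambda>s. l s u) \<longlongrightarrow> l z u) (at z within ?I)"
          have u: "u \<in> ?I" and v: "v \<in> ?I"
            using uv' by auto
          have zu: "l z u \<in> U" and zv: "l z v \<in> U"
            using d uv u v by auto
          obtain W where W: "open W" "U = C \<inter> W"
            using U(2) by (auto simp: openin_open)
          have "\<forall>\<^sub>F s in at z within ?I. l s u \<in> W"
            using topological_tendstoD[OF lim W(1)] zu W(2) by auto
          moreover have "\<forall>\<^sub>F s in at z within ?I. s \<in> ?I \<and> \<bar>s - z\<bar> < e/2"
            unfolding eventually_at using e(1) by (intro exI[of _ "e/2"]) (auto simp: dist_real_def)
          \<comment> \<open>For s close to z, the lifted slice is at time u in the same sheet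
            \<open>U\<close> as the slice over z. By uniqueness of lifts it then coincides on
            \<open>{u..v}\<close> with the sheet inverse \<open>q\<close> applied to the homotopy,
            and the latter is continuous in s.\<close>
          ultimately have "\<forall>\<^sub>F s in at z within ?I. q (K (s, v)) = l s v"
          proof eventually_elim
            case (elim s)
            then have s: "s \<in> ?I" "l s u \<in> U" "\<bar>s - z\<bar> < e/2"
              using W(2) lC u by auto
            have sub: "{u..v} \<subseteq> ?I"
              using uv' by auto
            have T: "K (s, t) \<in> T" if t: "t \<in> {u..v}" for t
            proof (rule KT[OF s(1) _ s(3)])
              show "\<bar>t - x\<bar> < e/2"
                using t uv unfolding abs_less_iff by auto
            qed (use t sub in blast)
            show "q (K (s, v)) = l s v"
            proof (rule covering_space_path_lift_unique[OF cov \<open>u \<le> v\<close>])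
              show "continuous_on {u..v} (\<lambda>t. q (K (s, t)))"
                using T by (intro continuous_on_compose2[OF contq] continuous_on_subset[OF Ks(1)[OF s(1)] sub]) auto
              show "continuous_on {u..v} (l s)"
                by (rule continuous_on_subset[OF l(1)[OF s(1)] sub])
              show "q (K (s, u)) = l s u"
                using l(4)[OF s(1) u] qU(3)[OF s(2)] by simp
              show "(\<lambda>t. q (K (s, t))) ` {u..v} \<subseteq> C"
                using T qU(1) UC by blast
              show "l s ` {u..v} \<subseteq> C"
                using lC s(1) sub by blast
              show "p (q (K (s, t))) = p (l s t)" if "t \<in> {u..v}" for t
                using T[OF that] qU(2) l(4)[OF s(1), of t] that sub by auto
            qed
          qed
          moreover have "((\<lambda>s. q (K (s, v))) \<longlongrightarrow> l z v) (at z within ?I)"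
          proof -
            let ?J = "?I \<inter> {z - e/2<..<z + e/2}"
            have "continuous_on ?J (\<lambda>s. q (K (s, v)))"
            proof (rule continuous_on_compose2[OF contq])
              show "continuous_on ?J (\<lambda>s. K (s, v))"
                using v by (intro continuous_on_compose2[OF K(1)] continuous_intros) auto
              have "\<bar>v - x\<bar> < e/2"
                using uv unfolding abs_less_iff by auto
              moreover have "\<bar>s - z\<bar> < e/2" if "s \<in> ?J" for s
                using that unfolding abs_less_iff by auto
              ultimately show "(\<lambda>s. K (s, v)) ` ?J \<subseteq> T"
                using KT v by blast
            qed
            then have "((\<lambda>s. q (K (s, v))) \<longlongrightarrow> q (K (z, v))) (at z within ?J)"
              using z e(1) by (auto simp: continuous_on_def)
            moreover have "at z within ?J = at z within ?I"
              using e(1) by (subst at_within_nhd[of z "{z - e/2<..<z + e/2}" ?I ?J]) auto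
            moreover have "q (K (z, v)) = l z v"
              using l(4)[OF z v] qU(3)[OF zv] by simp
            ultimately show ?thesis by simp
          qed
          ultimately show "((\<lambda>s. l s v) \<longlongrightarrow> l z v) (at z within ?I)"
            by (rule Lim_transform_eventually[rotated])
        qed
        then show ?thesis
          using d(1) e(1) by (intro exI[of _ "min d (e/2)"]) auto
      qed
    qed simp
    moreover have "((\<lambda>s. l s 0) \<longlongrightarrow> l z 0) (at z within ?I)"
      using l(3) z by (auto intro!: tendsto_eventually simp: eventually_at_filter)
    ultimately show "((\<lambda>s. l s 1) \<longlongrightarrow> l z 1) (at z within ?I)"
      by (simp add: P_def)
  qed
  have 0: "(0::real) \<in> ?I" and 1: "(1::real) \<in> ?I"
    by auto
  have "l 0 1 = g 1"
    by (rule covering_space_path_lift_unique[OF cov zero_le_one l(1,2)[OF 0]])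
      (use g gC K l in \<open>auto simp: path_def\<close>)
  moreover have "l 1 1 = h 1"
    by (rule covering_space_path_lift_unique[OF cov zero_le_one l(1,2)[OF 1]])
      (use h start K l in \<open>auto simp: path_def path_image_def pathstart_def\<close>)
  \<comment> \<open>Both the constant function and the endpoint function are lifts of the constant
    path at \<open>p (g 1)\<close>, and they agree at parameter 0.\<close>
  moreover have "(\<lambda>_::real. l 0 1) 1 = (\<lambda>s. l s 1) 1"
    by (rule covering_space_path_lift_unique[OF cov zero_le_one continuous_on_const _ cont])
      (use K(6) l(4)[OF _ 1] lC[OF _ 1] in auto)
  ultimately show ?thesis
    by (simp add: pathfinish_def)
qed

section \<open>Abelian quotients of the fundamental group as cohomology classes\<close>

text \<open>This makes closing up paths to loops multiplicative: \<open>a\<close>, \<open>b\<close>,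
  \<open>c\<close> are the chosen paths to the start of \<open>p\<close>, the junction, and the end
  of \<open>q\<close>, and the detour back and forth along \<open>b\<close> contracts.\<close>

lemma homotopic_paths_cancel_middle:
  fixes a :: "real \<Rightarrow> 'a::real_normed_vector"
  assumes a: "path a" "path_image a \<subseteq> S" and b: "path b" "path_image b \<subseteq> S"
    and c: "path c" "path_image c \<subseteq> S"
    and p: "path p" "path_image p \<subseteq> S" and q: "path q" "path_image q \<subseteq> S"
    and ends: "pathfinish a = pathstart p" "pathfinish b = pathfinish p" "pathstart q = pathfinish p"
      "pathfinish q = pathfinish c"
  shows "homotopic_paths S ((a +++ p +++ reversepath b) +++ (b +++ q +++ reversepath c))
    (a +++ (p +++ q) +++ reversepath c)"
proof -
  let ?r = "q +++ reversepath c"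
  have pth: "path ?r" "path (p +++ reversepath b)" "path (b +++ ?r)" "path (p +++ q)" "path (reversepath b +++ b)"
    and img: "path_image ?r \<subseteq> S" "path_image (p +++ reversepath b) \<subseteq> S" "path_image (b +++ ?r) \<subseteq> S"
      "path_image (p +++ q) \<subseteq> S" "path_image (reversepath b +++ b) \<subseteq> S"
    using assms by (simp_all add: path_image_join)
  have "homotopic_paths S (reversepath b +++ (b +++ ?r)) ((reversepath b +++ b) +++ ?r)"
    by (rule homotopic_paths_assoc) (use assms pth img in auto)
  also have "homotopic_paths S \<dots> (linepath (pathfinish b) (pathfinish b) +++ ?r)"
    by (rule homotopic_paths_join) (use homotopic_paths_linv[OF b] assms pth img in auto)
  also have "homotopic_paths S \<dots> ?r"
    by (rule homotopic_paths_lid') (use assms pth img in auto)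
  finally have 1: "homotopic_paths S (reversepath b +++ (b +++ ?r)) ?r" .
  have "homotopic_paths S ((p +++ reversepath b) +++ (b +++ ?r)) (p +++ (reversepath b +++ (b +++ ?r)))"
    by (rule homotopic_paths_sym[OF homotopic_paths_assoc]) (use assms pth img in auto)
  also have "homotopic_paths S \<dots> (p +++ ?r)"
    by (rule homotopic_paths_join[OF _ 1]) (use assms in auto)
  also have "homotopic_paths S \<dots> ((p +++ q) +++ reversepath c)"
    by (rule homotopic_paths_assoc) (use assms in auto)
  finally have 2: "homotopic_paths S ((p +++ reversepath b) +++ (b +++ ?r)) ((p +++ q) +++ reversepath c)" .
  have "homotopic_paths S ((a +++ p +++ reversepath b) +++ (b +++ ?r)) (a +++ ((p +++ reversepath b) +++ (b +++ ?r)))"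
    by (rule homotopic_paths_sym[OF homotopic_paths_assoc]) (use assms pth img in auto)
  also have "homotopic_paths S \<dots> (a +++ (p +++ q) +++ reversepath c)"
    by (rule homotopic_paths_join[OF _ 2]) (use assms in auto)
  finally show ?thesis .
qed

section \<open>Singular 1- and 2-simplices as paths and path homotopies\<close>

text \<open>Plane coordinates (s, t) become the barycentric coordinates (1 - s - t, s, t). The one
  formula parametrizes the standard 2-simplex by a plane triangle and, for t = 0, the standard
  1-simplex from vertex 0 to vertex 1.\<close>

definition simplex_point :: "real \<times> real \<Rightarrow> nat \<Rightarrow> real" where
  "simplex_point z = (\<lambda>i. if i = 0 then 1 - fst z - snd z else if i = 1 then fst z else if i = 2 then snd z else 0)"

definition simplex_path :: "((nat \<Rightarrow> real) \<Rightarrow> 'a) \<Rightarrow> real \<Rightarrow> 'a" where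
  "simplex_path \<sigma> t = \<sigma> (simplex_point (t, 0))"

lemma simplex_point_1: "t \<in> {0..1} \<Longrightarrow> simplex_point (t, 0) \<in> standard_simplex (Suc 0)"
  by (auto simp: simplex_point_def standard_simplex_def)

lemma simplex_point_2:
  "0 \<le> fst z \<Longrightarrow> 0 \<le> snd z \<Longrightarrow> fst z + snd z \<le> 1 \<Longrightarrow> simplex_point z \<in> standard_simplex 2"
  by (auto simp: simplex_point_def standard_simplex_def numeral_2_eq_2)

lemma continuous_on_simplex_point:
  assumes \<sigma>: "singular_simplex p (top_of_set Y) \<sigma>" and D: "simplex_point ` D \<subseteq> standard_simplex p"
  shows "continuous_on D (\<lambda>z. \<sigma> (simplex_point z))" and "(\<lambda>z. \<sigma> (simplex_point z)) ` D \<subseteq> Y"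
proof -
  have "continuous_map (top_of_set D) (powertop_real UNIV) simplex_point"
    unfolding continuous_map_componentwise_UNIV
  proof
    fix k
    show "continuous_map (top_of_set D) euclideanreal (\<lambda>z. simplex_point z k)"
      by (cases "k = 0"; cases "k = 1"; cases "k = 2") (auto simp: simplex_point_def intro!: continuous_intros)
  qed
  then have "continuous_map (top_of_set D) (subtopology (powertop_real UNIV) (standard_simplex p)) simplex_point"
    using D by (auto simp: continuous_map_in_subtopology)
  then have "continuous_map (top_of_set D) (top_of_set Y) (\<sigma> \<circ> simplex_point)"
    using \<sigma> unfolding singular_simplex_def by (blast intro: continuous_map_compose)
  then show "continuous_on D (\<lambda>z. \<sigma> (simplex_point z))" "(\<lambda>z. \<sigma> (simplex_point z)) ` D \<subseteq> Y"
    by (auto simp: o_def)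
qed

lemma simplex_path:
  assumes "singular_simplex (Suc 0) (top_of_set Y) \<sigma>"
  shows "path (simplex_path \<sigma>)" and "path_image (simplex_path \<sigma>) \<subseteq> Y"
proof -
  have D: "simplex_point ` ({0..1} \<times> {0}) \<subseteq> standard_simplex (Suc 0)"
    using simplex_point_1 by auto
  note * = continuous_on_simplex_point[OF assms D]
  show "path (simplex_path \<sigma>)"
    unfolding path_def simplex_path_def
    by (rule continuous_on_compose2[OF *(1)]) (auto intro!: continuous_intros)
  show "path_image (simplex_path \<sigma>) \<subseteq> Y"
    using *(2) by (auto simp: path_image_def simplex_path_def)
qed

text \<open>This is the geometric content of the cocycle condition. Pulled back to a plane triangle,
  faces 2, 0 and 1 are the edges 01, 12 and 02; the two ways from vertex 0 to vertex 2 are joined by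
  the straight-line homotopy in the convex triangle.\<close>

lemma simplex_path_triangle:
  fixes \<tau> :: "(nat \<Rightarrow> real) \<Rightarrow> 'a::topological_space"
  assumes \<tau>: "singular_simplex 2 (top_of_set Y) \<tau>"
  shows "homotopic_paths Y
    (simplex_path (singular_face 2 2 \<tau>) +++ simplex_path (singular_face 2 0 \<tau>))
    (simplex_path (singular_face 2 1 \<tau>))"
    and "pathfinish (simplex_path (singular_face 2 2 \<tau>)) = pathstart (simplex_path (singular_face 2 0 \<tau>))"
proof -
  define T :: "(real \<times> real) set" where "T = {z. 0 \<le> fst z \<and> 0 \<le> snd z \<and> fst z + snd z \<le> 1}"
  define F where "F = (\<lambda>z. \<tau> (simplex_point z))"
  have D: "simplex_point ` T \<subseteq> standard_simplex 2"
    using simplex_point_2 by (auto simp: T_def)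
  note F = continuous_on_simplex_point[OF \<tau> D, folded F_def]
  have conv: "convex T"
  proof -
    have "T = {z. inner (-1, 0) z \<le> 0} \<inter> {z. inner (0, -1) z \<le> 0} \<inter> {z. inner (1, 1) z \<le> 1}"
      by (auto simp: T_def inner_prod_def)
    then show ?thesis
      by (simp add: convex_Int convex_halfspace_le)
  qed
  have seg: "closed_segment x y \<subseteq> T" if "x \<in> T" "y \<in> T" for x y
    using conv that by (simp add: closed_segment_subset)
  have T: "(0, 0) \<in> T" "(1, 0) \<in> T" "(0, 1) \<in> T"
    by (auto simp: T_def)
  have sf: "simplical_face 2 (simplex_point (t, 0)) = simplex_point (t, 0)"
    "simplical_face 0 (simplex_point (t, 0)) = simplex_point (1 - t, t)"
    "simplical_face (Suc 0) (simplex_point (t, 0)) = simplex_point (0, t)" for t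
    by (auto simp: simplical_face_def simplex_point_def fun_eq_iff)
  have face: "simplex_path (singular_face 2 2 \<tau>) t = (F \<circ> linepath (0, 0) (1, 0)) t"
    "simplex_path (singular_face 2 0 \<tau>) t = (F \<circ> linepath (1, 0) (0, 1)) t"
    "simplex_path (singular_face 2 1 \<tau>) t = (F \<circ> linepath (0, 0) (0, 1)) t" if "t \<in> {0..1}" for t
    using simplex_point_1[OF that]
    by (simp_all add: simplex_path_def singular_face_def F_def sf linepath_def)
  show ends: "pathfinish (simplex_path (singular_face 2 2 \<tau>)) = pathstart (simplex_path (singular_face 2 0 \<tau>))"
    unfolding pathfinish_def pathstart_def using face(1)[of 1] face(2)[of 0] by (simp add: linepath_def)
  let ?l1 = "linepath (0, 0) (1, 0) :: real \<Rightarrow> real \<times> real" and ?l2 = "linepath (1, 0) (0, 1) :: real \<Rightarrow> real \<times> real"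
  have "homotopic_paths T (?l1 +++ ?l2) (linepath (0, 0) (0, 1))"
  proof (rule homotopic_paths_linear)
    fix t :: real assume t: "t \<in> {0..1}"
    have "path_image (?l1 +++ ?l2) \<subseteq> T"
      using seg T by (simp add: path_image_join)
    moreover have "path_image (linepath (0, 0) (0, 1)) \<subseteq> T"
      using seg T by simp
    ultimately have "(?l1 +++ ?l2) t \<in> T" "linepath (0, 0) (0, 1) t \<in> T"
      using t unfolding path_image_def by blast+
    then show "closed_segment ((?l1 +++ ?l2) t) (linepath (0, 0) (0, 1) t) \<subseteq> T"
      by (rule seg)
  qed auto
  then have hom: "homotopic_paths Y ((F \<circ> ?l1) +++ (F \<circ> ?l2)) (F \<circ> linepath (0, 0) (0, 1))"
    using homotopic_paths_continuous_image[OF _ F(1), of _ _ Y] F(2)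
    by (metis image_subset_iff_funcset path_compose_join)
  have fp: "path (F \<circ> linepath x y)" "path_image (F \<circ> linepath x y) \<subseteq> Y" if "x \<in> T" "y \<in> T" for x y
    using seg[OF that] F
    by (auto simp: path_image_compose intro!: path_continuous_image intro: continuous_on_subset)
  \<comment> \<open>A face is undefined off the standard simplex, so its path is only known to match
    the edge on \<open>{0..1}\<close>; homotopy replaces equality of functions.\<close>
  have eq: "homotopic_paths Y (F \<circ> linepath x y) p"
    if "x \<in> T" "y \<in> T" "\<And>t. t \<in> {0..1} \<Longrightarrow> p t = (F \<circ> linepath x y) t" for x y p
    using that(3) by (intro homotopic_paths_eq fp that(1,2)) simp
  note eqs = eq[OF T(1,2) face(1)] eq[OF T(2,3) face(2)] eq[OF T(1,3) face(3)]
  show "homotopic_paths Y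
    (simplex_path (singular_face 2 2 \<tau>) +++ simplex_path (singular_face 2 0 \<tau>))
    (simplex_path (singular_face 2 1 \<tau>))"
    using homotopic_paths_trans[OF homotopic_paths_trans[OF
          homotopic_paths_join[OF eqs(1,2)[THEN homotopic_paths_sym] ends] hom] eqs(3)] .
qed

lemma hom_chain_group_eq_oneI:
  assumes Q: "comm_group Q" and k: "k \<in> hom (chain_group p X) Q"
    and one: "\<And>\<sigma>. singular_simplex p X \<sigma> \<Longrightarrow> k (frag_of \<sigma>) = \<one>\<^bsub>Q\<^esub>" and c: "singular_chain p X c"
  shows "k c = \<one>\<^bsub>Q\<^esub>"
proof -
  interpret Q: comm_group Q by (rule Q)
  interpret k: group_hom "chain_group p X" Q k
    using k by (simp add: group_hom_def group_hom_axioms_def)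
  \<comment> \<open>The induction splits c into differences without saying that the parts are chains
    of \<open>X\<close>, while \<open>k\<close> is known to be multiplicative only on such chains;
    hence the first conjunct.\<close>
  have "singular_chain p X c \<and> k c = \<one>\<^bsub>Q\<^esub>"
    using c[unfolded singular_chain_def]
  proof (induction c rule: frag_induction)
    case zero
    then show ?case using k.hom_one by simp
  next
    case (one x)
    then show ?case using assms(3) by (simp add: singular_chain_of)
  next
    case (diff a b)
    then have "singular_chain p X (a - b)"
      by (simp add: singular_chain_diff)
    then show ?case
      using k.hom_mult[of "a - b" b] k.hom_closed[of "a - b"] diff by simp
  qed
  then show ?thesis by blast
qed


text \<open>With a chosen path \<open>\<gamma> y\<close> from the base point to each \<open>y\<close>, closing up a 1-simplex to a loop
  defines a 1-cocycle with values in the quotient by \<open>N\<close>.\<close>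

lemma abelian_quotient_of_fundamental_group_trivial:
  fixes Y :: "'a::real_normed_vector set" and X :: "'a topology" and \<gamma> :: "'a \<Rightarrow> real \<Rightarrow> 'a"
    and x\<^sub>0 :: 'a
  defines "G \<equiv> fundamental_group Y x\<^sub>0"
  assumes x0: "x\<^sub>0 \<in> Y" and N: "N \<lhd> G" and comm: "comm_group (G Mod N)"
    and \<gamma>: "\<And>y. y \<in> Y \<Longrightarrow> path (\<gamma> y)" "\<And>y. y \<in> Y \<Longrightarrow> path_image (\<gamma> y) \<subseteq> Y"
      "\<And>y. y \<in> Y \<Longrightarrow> pathstart (\<gamma> y) = x\<^sub>0" "\<And>y. y \<in> Y \<Longrightarrow> pathfinish (\<gamma> y) = y"
    and f: "continuous_map X (top_of_set Y) f"
    and inj: "inj_on (cohomology_induced (Suc 0) X (G Mod N) f)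
      (carrier (cohomology_group (Suc 0) (top_of_set Y) (G Mod N)))"
    and triv: "\<And>\<sigma>. singular_simplex (Suc 0) X \<sigma> \<Longrightarrow>
      path_class Y (\<gamma> (f (pathstart (simplex_path \<sigma>))) +++ (f \<circ> simplex_path \<sigma>) +++
        reversepath (\<gamma> (f (pathfinish (simplex_path \<sigma>))))) \<in> N"
  shows "N = carrier G"
proof -
  interpret normal N G by (rule N)
  let ?Y = "top_of_set Y"
  define Q where "Q = G Mod N"
  interpret Q: comm_group Q
    unfolding Q_def by (rule comm)
  define e where "e p = path_class Y (\<gamma> (pathstart p) +++ p +++ reversepath (\<gamma> (pathfinish p)))" for p
  have carr: "carrier G = path_class Y ` loops_at Y x\<^sub>0"
    by (simp add: G_def fundamental_group_def)
  have class_eq: "path_class Y p = path_class Y q" if "homotopic_paths Y p q" for p q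
    using that path_class_eq_iff[of p Y q] homotopic_paths_imp_path homotopic_paths_imp_subset by blast
  have ends: "pathstart p \<in> Y" "pathfinish p \<in> Y" if "path_image p \<subseteq> Y" for p :: "real \<Rightarrow> 'a"
    using that pathstart_in_path_image pathfinish_in_path_image by blast+
  have loop: "\<gamma> (pathstart p) +++ p +++ reversepath (\<gamma> (pathfinish p)) \<in> loops_at Y x\<^sub>0"
    if "path p" "path_image p \<subseteq> Y" for p
    using that ends[OF that(2)] \<gamma> by (auto simp: loops_at_def path_image_join subset_iff)
  have e_carr: "e p \<in> carrier G" if "path p" "path_image p \<subseteq> Y" for p
    using loop[OF that] by (auto simp: e_def carr)
  have e_join: "e (p +++ q) = e p \<otimes>\<^bsub>G\<^esub> e q"
    if p: "path p" "path_image p \<subseteq> Y" and q: "path q" "path_image q \<subseteq> Y" and pq: "pathfinish p = pathstart q" for p q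
  proof -
    have "e p \<otimes>\<^bsub>G\<^esub> e q = path_class Y
        ((\<gamma> (pathstart p) +++ p +++ reversepath (\<gamma> (pathfinish p))) +++
         (\<gamma> (pathstart q) +++ q +++ reversepath (\<gamma> (pathfinish q))))"
      unfolding e_def G_def by (rule mult_path_class[OF loop[OF p] loop[OF q]])
    also have "\<dots> = e (p +++ q)"
      unfolding e_def pq pathstart_join pathfinish_join
      by (rule class_eq, rule homotopic_paths_cancel_middle)
        (use p q pq ends[OF p(2)] ends[OF q(2)] \<gamma> in simp_all)
    finally show ?thesis ..
  qed
  have e_hom: "e p = e q" if "homotopic_paths Y p q" for p q
  proof -
    have "path p" "path_image p \<subseteq> Y"
      using that homotopic_paths_imp_path homotopic_paths_imp_subset by blast+
    then have "homotopic_paths Y (\<gamma> (pathstart p) +++ p +++ reversepath (\<gamma> (pathfinish p)))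
        (\<gamma> (pathstart p) +++ q +++ reversepath (\<gamma> (pathfinish p)))"
      using that ends[of p] \<gamma> homotopic_paths_imp_pathfinish[OF that] homotopic_paths_imp_pathstart[OF that]
      by (intro homotopic_paths_join) auto
    then show ?thesis
      using class_eq homotopic_paths_imp_pathfinish[OF that] homotopic_paths_imp_pathstart[OF that]
      by (simp add: e_def)
  qed
  note sp = simplex_path[of Y]
  have Q_carr: "N #>\<^bsub>G\<^esub> x \<in> carrier Q" if "x \<in> carrier G" for x
    using that by (auto simp: Q_def carrier_FactGroup)
  have Q_one: "N #>\<^bsub>G\<^esub> x = \<one>\<^bsub>Q\<^esub>" if "x \<in> N" for x
    using that coset_join2[OF mem_carrier subgroup_axioms] by (simp add: Q_def)
  \<comment> \<open>Commutativity of the quotient enters here: the chain group is free abelian, and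
    its universal property extends values on simplices to homomorphisms into commutative
    groups.\<close>
  obtain h where h: "h \<in> hom (chain_group (Suc 0) ?Y) Q"
    and h_of: "\<And>\<sigma>. singular_simplex (Suc 0) ?Y \<sigma> \<Longrightarrow> h (frag_of \<sigma>) = N #>\<^bsub>G\<^esub> e (simplex_path \<sigma>)"
  proof -
    have "(\<lambda>\<sigma>. N #>\<^bsub>G\<^esub> e (simplex_path \<sigma>)) ` singular_simplex_set (Suc 0) ?Y \<subseteq> carrier Q"
      using sp e_carr Q_carr by blast
    then show thesis
      using Q.free_Abelian_group_universal that unfolding chain_group_def by (metis mem_Collect_eq)
  qed
  have h_add: "h (c + d) = h c \<otimes>\<^bsub>Q\<^esub> h d" and h_closed: "h c \<in> carrier Q"
    if "singular_chain (Suc 0) ?Y c" "singular_chain (Suc 0) ?Y d" for c d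
    using h that by (auto simp: hom_def)
  define u where "u = (\<lambda>c\<in>singular_chain_set (Suc 0) ?Y. h c)"
  have uc: "u \<in> carrier (cochain_group (Suc 0) ?Y Q)"
    using h_add h_closed by (auto simp: u_def carrier_cochain_group[OF Q.comm_group_axioms] singular_chain_add)
  have bd: "singular_chain (Suc 0) ?Y (chain_boundary 2 c)" if "singular_chain 2 ?Y c" for c
    using singular_chain_boundary[OF that] by (simp add: numeral_2_eq_2)
  have "h (chain_boundary 2 c) = \<one>\<^bsub>Q\<^esub>" if "singular_chain 2 ?Y c" for c
  proof (rule hom_chain_group_eq_oneI[OF Q.comm_group_axioms _ _ that])
    show "(\<lambda>c. h (chain_boundary 2 c)) \<in> hom (chain_group 2 ?Y) Q"
      using bd h_closed h_add by (auto simp: hom_def chain_boundary_add)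
    fix \<tau> assume \<tau>: "singular_simplex 2 ?Y \<tau>"
    let ?f = "\<lambda>k. singular_face 2 k \<tau>"
    have s: "singular_simplex (Suc 0) ?Y (?f k)" if "k \<le> 2" for k
      using singular_simplex_singular_face[OF \<tau> _ that] by (simp add: numeral_2_eq_2)
    \<comment> \<open>The middle face, which has sign -1 in the boundary, is moved to the left so
      that no inverse occurs in \<open>Q\<close>; its value is cancelled at the end.\<close>
    have "chain_boundary 2 (frag_of \<tau>) + frag_of (?f 1) = frag_of (?f 2) + frag_of (?f 0)"
      by (simp add: chain_boundary_of numeral_2_eq_2)
    then have "h (chain_boundary 2 (frag_of \<tau>)) \<otimes>\<^bsub>Q\<^esub> h (frag_of (?f 1)) = h (frag_of (?f 2)) \<otimes>\<^bsub>Q\<^esub> h (frag_of (?f 0))"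
      using s bd[of "frag_of \<tau>"] \<tau> by (simp flip: h_add add: singular_chain_of)
    also have "\<dots> = N #>\<^bsub>G\<^esub> (e (simplex_path (?f 2)) \<otimes>\<^bsub>G\<^esub> e (simplex_path (?f 0)))"
      using s sp e_carr by (simp add: h_of Q_def rcos_sum)
    also have "e (simplex_path (?f 2)) \<otimes>\<^bsub>G\<^esub> e (simplex_path (?f 0)) = e (simplex_path (?f 1))"
      using s sp simplex_path_triangle[OF \<tau>] e_hom by (simp flip: e_join)
    also have "N #>\<^bsub>G\<^esub> e (simplex_path (?f 1)) = h (frag_of (?f 1))"
      using s by (simp add: h_of)
    finally show "h (chain_boundary 2 (frag_of \<tau>)) = \<one>\<^bsub>Q\<^esub>"
      using h_closed s bd[of "frag_of \<tau>"] \<tau> by (simp add: singular_chain_of)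
  qed
  then have "cochain_coboundary (Suc 0) ?Y u = \<one>\<^bsub>cochain_group (Suc (Suc 0)) ?Y Q\<^esub>"
    using bd by (intro ext) (simp add: cochain_coboundary_def cochain_group_def u_def numeral_2_eq_2)
  then have u: "u \<in> cocycle_set (Suc 0) ?Y Q"
    using uc by (simp add: cocycle_set_def kernel_def)
  have ch: "singular_chain (Suc 0) ?Y (chain_map (Suc 0) f c)" if "singular_chain (Suc 0) X c" for c
    using singular_chain_chain_map[OF that f] .
  \<comment> \<open>The pulled-back cocycle is identically one, not merely cohomologous to it,
    because \<open>triv\<close> puts each closed-up simplex of \<open>X\<close> into
    \<open>N\<close>. No 0-cochain on \<open>X\<close> has to be produced.\<close>
  have "h (chain_map (Suc 0) f c) = \<one>\<^bsub>Q\<^esub>" if "singular_chain (Suc 0) X c" for c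
  proof (rule hom_chain_group_eq_oneI[OF Q.comm_group_axioms _ _ that])
    show "(\<lambda>c. h (chain_map (Suc 0) f c)) \<in> hom (chain_group (Suc 0) X) Q"
      using ch h_closed h_add by (auto simp: hom_def chain_map_add)
    fix \<sigma> assume \<sigma>: "singular_simplex (Suc 0) X \<sigma>"
    let ?\<sigma> = "simplex_map (Suc 0) f \<sigma>"
    have s: "singular_simplex (Suc 0) ?Y ?\<sigma>"
      by (rule singular_simplex_simplex_map[OF \<sigma> f])
    have eq: "simplex_path ?\<sigma> t = (f \<circ> simplex_path \<sigma>) t" if "t \<in> {0..1}" for t
      using simplex_point_1[OF that] by (simp add: simplex_path_def simplex_map_def)
    have "e (simplex_path ?\<sigma>) = e (f \<circ> simplex_path \<sigma>)"
      using e_hom homotopic_paths_eq[OF sp[OF s]] eq by metis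
    also have "\<dots> \<in> N"
      using triv[OF \<sigma>] by (simp add: e_def pathstart_compose pathfinish_compose)
    finally show "h (chain_map (Suc 0) f (frag_of \<sigma>)) = \<one>\<^bsub>Q\<^esub>"
      using s Q_one by (simp add: h_of)
  qed
  then have "cochain_map (Suc 0) X f u = \<one>\<^bsub>cochain_group (Suc 0) X Q\<^esub>"
    using ch by (intro ext) (simp add: cochain_map_def cochain_group_def u_def)
  then have "cochain_map (Suc 0) X f u \<in> coboundary_set (Suc 0) X Q"
    using subgroup.one_closed[OF coboundary_set_subgroup[OF Q.comm_group_axioms]] by metis
  then have "u \<in> coboundary_set (Suc 0) ?Y Q"
    using inj u unfolding inj_cohomology_induced_iff[OF comm f] Q_def by blast
  then obtain w where w: "w \<in> carrier (cochain_group 0 ?Y Q)" "u = cochain_coboundary 0 ?Y w"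
    by (auto simp: coboundary_set_def)
  have "w 0 = \<one>\<^bsub>Q\<^esub>"
    using group_hom.hom_one[OF cochain_hom[OF Q.comm_group_axioms w(1)]] by simp
  have e_N: "e l \<in> N" if l: "l \<in> loops_at Y x\<^sub>0" for l
  proof -
    \<comment> \<open>The loop is read off barycentric coordinate 1, in agreement with the direction
      of \<open>simplex_path\<close>. As its ends coincide, the two faces are equal, the boundary is
      0, and the coboundary of \<open>w\<close> takes the value \<open>w 0\<close>, which is
      one.\<close>
    define \<sigma> where "\<sigma> = restrict (\<lambda>x. l (x 1)) (standard_simplex (Suc 0))"
    have lc: "continuous_on {0..1} l" "l ` {0..1} \<subseteq> Y" "l 0 = l 1"
      using l by (auto simp: loops_at_def path_def path_image_def pathstart_def pathfinish_def)
    have \<sigma>: "singular_simplex (Suc 0) ?Y \<sigma>"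
      unfolding singular_simplex_def
    proof
      have "continuous_map (subtopology (powertop_real UNIV) (standard_simplex (Suc 0))) (top_of_set {0..1}) (\<lambda>x. x 1)"
        using standard_simplex_01[of "Suc 0"]
        by (auto simp: continuous_map_in_subtopology intro!: continuous_map_from_subtopology continuous_map_product_projection)
      moreover have "continuous_map (top_of_set {0..1}) ?Y l"
        using lc by auto
      ultimately have "continuous_map (subtopology (powertop_real UNIV) (standard_simplex (Suc 0))) ?Y (l \<circ> (\<lambda>x. x 1))"
        by (rule continuous_map_compose)
      then show "continuous_map (subtopology (powertop_real UNIV) (standard_simplex (Suc 0))) ?Y \<sigma>"
        by (rule continuous_map_eq) (auto simp: \<sigma>_def)
    qed (simp add: \<sigma>_def)
    have "singular_face (Suc 0) 0 \<sigma> = singular_face (Suc 0) (Suc 0) \<sigma>"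
      using lc(3) by (auto simp: singular_face_def \<sigma>_def simplical_face_def standard_simplex_0 standard_simplex_def fun_eq_iff restrict_def)
    then have "chain_boundary (Suc 0) (frag_of \<sigma>) = 0"
      by (simp add: chain_boundary_of)
    then have "u (frag_of \<sigma>) = \<one>\<^bsub>Q\<^esub>"
      using w(2) \<sigma> \<open>w 0 = _\<close> by (simp add: cochain_coboundary_def singular_chain_of)
    moreover have "u (frag_of \<sigma>) = N #>\<^bsub>G\<^esub> e (simplex_path \<sigma>)"
      using \<sigma> by (simp add: u_def h_of singular_chain_of)
    moreover have "e (simplex_path \<sigma>) = e l"
    proof -
      have "simplex_path \<sigma> t = l t" if "t \<in> {0..1}" for t
        using simplex_point_1[OF that] by (simp add: simplex_path_def \<sigma>_def) (simp add: simplex_point_def)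
      then show ?thesis
        using e_hom homotopic_paths_eq[OF sp[OF \<sigma>]] by metis
    qed
    ultimately have "N #>\<^bsub>G\<^esub> e l = N"
      by (simp add: Q_def)
    then show "e l \<in> N"
      using rcos_self[OF _ subgroup_axioms, of "e l"] e_carr l by (auto simp: loops_at_def)
  qed
  show ?thesis
  proof
    show "N \<subseteq> carrier G" by (rule subset)
    show "carrier G \<subseteq> N"
    proof
      fix x assume "x \<in> carrier G"
      then obtain l where l: "l \<in> loops_at Y x\<^sub>0" "x = path_class Y l"
        by (auto simp: carr)
      \<comment> \<open>The chosen path at the base point itself may be a nontrivial loop, so
        \<open>e l\<close> is only a conjugate of the class of \<open>l\<close>; normality of
        \<open>N\<close> undoes the conjugation.\<close>
      let ?g = "\<gamma> x\<^sub>0"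
      have g: "?g \<in> loops_at Y x\<^sub>0" "reversepath ?g \<in> loops_at Y x\<^sub>0"
        using \<gamma>[OF x0] by (auto simp: loops_at_def)
      define a where "a = path_class Y ?g"
      define b where "b = path_class Y (reversepath ?g)"
      have ab: "a \<in> carrier G" "b \<in> carrier G"
        using g by (auto simp: a_def b_def carr)
      have "b \<otimes>\<^bsub>G\<^esub> a = path_class Y (reversepath ?g +++ ?g)"
        unfolding a_def b_def G_def by (rule mult_path_class[OF g(2,1)])
      also have "\<dots> = \<one>\<^bsub>G\<^esub>"
        using class_eq[OF homotopic_paths_linv[of ?g Y]] \<gamma>[OF x0] by (simp add: G_def fundamental_group_def)
      finally have "a = inv\<^bsub>G\<^esub> b"
        using ab inv_unique' inv_equality by (metis inv_inv)
      moreover have "e l = a \<otimes>\<^bsub>G\<^esub> (x \<otimes>\<^bsub>G\<^esub> b)"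
        using l g mult_path_class[of _ Y x\<^sub>0] loops_at_join[of _ Y x\<^sub>0]
        by (auto simp: e_def a_def b_def G_def loops_at_def)
      moreover have "e l \<in> N"
        using e_N l(1) by blast
      ultimately have "b \<otimes>\<^bsub>G\<^esub> (inv\<^bsub>G\<^esub> b \<otimes>\<^bsub>G\<^esub> (x \<otimes>\<^bsub>G\<^esub> b)) \<otimes>\<^bsub>G\<^esub> inv\<^bsub>G\<^esub> b \<in> N"
        using inv_op_closed2[OF ab(2)] by simp
      also have "b \<otimes>\<^bsub>G\<^esub> (inv\<^bsub>G\<^esub> b \<otimes>\<^bsub>G\<^esub> (x \<otimes>\<^bsub>G\<^esub> b)) \<otimes>\<^bsub>G\<^esub> inv\<^bsub>G\<^esub> b = x"
        using ab \<open>x \<in> carrier G\<close> by (simp flip: m_assoc) (simp add: m_assoc)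
      finally show "x \<in> N" .
    qed
  qed
qed

section \<open>Coverings and the fundamental group\<close>

lemma homotopic_paths_cancel_right:
  fixes a :: "real \<Rightarrow> 'a::real_normed_vector"
  assumes a: "path a" "path_image a \<subseteq> S" and b: "path b" "path_image b \<subseteq> S" and ab: "pathfinish a = pathfinish b"
  shows "homotopic_paths S ((a +++ reversepath b) +++ b) a"
proof -
  have "homotopic_paths S ((a +++ reversepath b) +++ b) (a +++ (reversepath b +++ b))"
    by (rule homotopic_paths_sym[OF homotopic_paths_assoc]) (use assms in auto)
  also have "homotopic_paths S \<dots> (a +++ linepath (pathfinish a) (pathfinish a))"
    unfolding ab by (rule homotopic_paths_join) (use homotopic_paths_linv[OF b] assms in auto)
  also have "homotopic_paths S \<dots> a"
    by (rule homotopic_paths_rid[OF a])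
  finally show ?thesis .
qed

lemma inv_path_class:
  assumes x: "x \<in> S" and p: "p \<in> loops_at S x"
  shows "inv\<^bsub>fundamental_group S x\<^esub> path_class S p = path_class S (reversepath p)"
proof -
  interpret group "fundamental_group S x"
    by (rule group_fundamental_group[OF x])
  have r: "reversepath p \<in> loops_at S x"
    using p by (auto simp: loops_at_def)
  have "homotopic_paths S (reversepath p +++ p) (linepath x x)"
    using p homotopic_paths_linv[of p S] by (auto simp: loops_at_def)
  then have "path_class S (reversepath p) \<otimes>\<^bsub>fundamental_group S x\<^esub> path_class S p = \<one>\<^bsub>fundamental_group S x\<^esub>"
    unfolding mult_path_class[OF r p]
    by (metis (no_types) fundamental_group_def homotopic_paths_imp_path homotopic_paths_imp_subset
        monoid.select_convs(2) path_class_eq_iff)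
  then show ?thesis
    using p r by (intro inv_equality) (auto simp: fundamental_group_def)
qed

text \<open>Given directly as a set of classes of projected loops: \<open>fundamental_group\<close>
  is typed for normed vector spaces, whereas \<open>M\<close> lies in an arbitrary topological type,
  so the group of \<open>M\<close> is not formed.\<close>

definition image_fundamental_group :: "'a::topological_space set \<Rightarrow> 'a \<Rightarrow> 'b::topological_space set \<Rightarrow> ('a \<Rightarrow> 'b) \<Rightarrow> (real \<Rightarrow> 'b) set set"
  where "image_fundamental_group M m S p = (\<lambda>l. path_class S (p \<circ> l)) ` loops_at M m"

lemma loops_at_compose:
  assumes "continuous_on M p" "p ` M \<subseteq> S" "l \<in> loops_at M m"
  shows "p \<circ> l \<in> loops_at S (p m)"
  using assms
  by (auto simp: loops_at_def path_image_compose pathstart_compose pathfinish_compose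
      intro!: path_continuous_image intro: continuous_on_subset)

lemma subgroup_image_fundamental_group:
  fixes S :: "'b::real_normed_vector set"
  assumes m: "m \<in> M" and p: "continuous_on M p" "p ` M \<subseteq> S"
  shows "subgroup (image_fundamental_group M m S p) (fundamental_group S (p m))"
proof -
  have pm: "p m \<in> S"
    using m p by blast
  interpret group "fundamental_group S (p m)"
    by (rule group_fundamental_group[OF pm])
  note lc = loops_at_compose[OF p]
  show ?thesis
  proof (rule subgroupI)
    show "image_fundamental_group M m S p \<subseteq> carrier (fundamental_group S (p m))"
      using lc by (auto simp: image_fundamental_group_def fundamental_group_def)
    have "(\<lambda>_. m) \<in> loops_at M m"
      using m by (auto simp: loops_at_def path_def path_image_def pathstart_def pathfinish_def)
    then show "image_fundamental_group M m S p \<noteq> {}"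
      by (auto simp: image_fundamental_group_def)
  next
    fix a assume "a \<in> image_fundamental_group M m S p"
    then obtain l where l: "l \<in> loops_at M m" "a = path_class S (p \<circ> l)"
      by (auto simp: image_fundamental_group_def)
    have "reversepath l \<in> loops_at M m"
      using l(1) by (auto simp: loops_at_def)
    then show "inv\<^bsub>fundamental_group S (p m)\<^esub> a \<in> image_fundamental_group M m S p"
      unfolding l(2) inv_path_class[OF pm lc[OF l(1)]] path_compose_reversepath[symmetric]
      by (auto simp: image_fundamental_group_def)
  next
    fix a b assume "a \<in> image_fundamental_group M m S p" "b \<in> image_fundamental_group M m S p"
    then obtain k l where kl: "k \<in> loops_at M m" "a = path_class S (p \<circ> k)" "l \<in> loops_at M m" "b = path_class S (p \<circ> l)"
      by (auto simp: image_fundamental_group_def)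
    then show "a \<otimes>\<^bsub>fundamental_group S (p m)\<^esub> b \<in> image_fundamental_group M m S p"
      unfolding kl mult_path_class[OF lc[OF kl(1)] lc[OF kl(3)]] path_compose_join[symmetric]
      by (auto simp: image_fundamental_group_def loops_at_join)
  qed
qed

text \<open>Join m to two points of one fibre by g and h. The projection of g followed by that of h
  reversed is a loop, hence homotopic to the projection of a loop k of \<open>M\<close>. Then k
  followed by h and g start together and have homotopic projections, so they end at the same
  point.\<close>

lemma covering_space_inj_on_if_surjective:
  fixes S :: "'b::real_normed_vector set" and M :: "'a::topological_space set"
  assumes cov: "covering_space M p S" and M: "path_connected M" "m \<in> M"
    and surj: "image_fundamental_group M m S p = carrier (fundamental_group S (p m))"
  shows "inj_on p M"
proof (rule inj_onI)
  fix x y assume xy: "x \<in> M" "y \<in> M" "p x = p y"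
  obtain g where g: "path g" "path_image g \<subseteq> M" "pathstart g = m" "pathfinish g = x"
    using M xy(1) unfolding path_connected_def by blast
  obtain h where h: "path h" "path_image h \<subseteq> M" "pathstart h = m" "pathfinish h = y"
    using M xy(2) unfolding path_connected_def by blast
  have pc: "path (p \<circ> l)" "path_image (p \<circ> l) \<subseteq> S" if "path l" "path_image l \<subseteq> M" for l
    using that cov by (auto simp: covering_space_def path_image_compose
        intro!: path_continuous_image intro: continuous_on_subset)
  let ?l = "(p \<circ> g) +++ reversepath (p \<circ> h)"
  have l: "?l \<in> loops_at S (p m)"
    using pc[OF g(1,2)] pc[OF h(1,2)] g h xy(3)
    by (simp add: loops_at_def path_image_join pathstart_compose pathfinish_compose)
  then have "path_class S ?l \<in> image_fundamental_group M m S p"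
    unfolding surj by (simp add: fundamental_group_def)
  then obtain k where k: "k \<in> loops_at M m" "path_class S ?l = path_class S (p \<circ> k)"
    by (auto simp: image_fundamental_group_def)
  note kD = k(1)[unfolded loops_at_def mem_Collect_eq]
  have hom: "homotopic_paths S ?l (p \<circ> k)"
    using k(2) l path_class_eq_iff[of ?l S "p \<circ> k"] unfolding loops_at_def by blast
  have "homotopic_paths S (p \<circ> (k +++ h)) (?l +++ (p \<circ> h))"
    unfolding path_compose_join
    using hom kD h pc[OF h(1,2)]
    by (intro homotopic_paths_join homotopic_paths_sym[OF hom]) (auto simp: pathstart_compose pathfinish_compose)
  also have "homotopic_paths S \<dots> (p \<circ> g)"
    using pc[OF g(1,2)] pc[OF h(1,2)] g h xy(3)
    by (intro homotopic_paths_cancel_right) (auto simp: pathfinish_compose)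
  finally have "pathfinish (k +++ h) = pathfinish g"
    by (rule covering_space_path_monodromy[OF cov]) (use kD g h in \<open>auto simp: path_image_join\<close>)
  then show "x = y"
    using g h by simp
qed

section \<open>Injective local biholomorphisms\<close>

text \<open>Derivatives are taken at z in the full space, so holomorphy on \<open>{z}\<close>
  already means complex differentiability at z and is unaffected by changing the function away from
  z. This allows the local inverses of restricted maps to replace global ones.\<close>

lemma scv_holomorphic_map_on_locallyI:
  assumes "\<And>z. z \<in> S \<Longrightarrow> \<exists>T g. open T \<and> z \<in> T \<and> (\<forall>w\<in>T. g w = f w) \<and> scv_holomorphic_map_on g {z}"
  shows "scv_holomorphic_map_on f S"
  unfolding scv_holomorphic_map_on_def scv_holomorphic_on_def
proof (intro allI ballI)
  fix i z assume "z \<in> S"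
  then obtain T g where T: "open T" "z \<in> T" "\<forall>w\<in>T. g w = f w" and g: "scv_holomorphic_map_on g {z}"
    using assms by meson
  obtain f' where f': "((\<lambda>w. g w $ i) has_derivative f') (at z)" "\<forall>c v. f' (c *s v) = c * f' v"
    using g unfolding scv_holomorphic_map_on_def scv_holomorphic_on_def by blast
  have "((\<lambda>w. f w $ i) has_derivative f') (at z)"
    by (rule has_derivative_transform_within_open[OF f'(1) T(1,2)]) (use T(3) in auto)
  then show "\<exists>f'. ((\<lambda>w. f w $ i) has_derivative f') (at z) \<and> (\<forall>c v. f' (c *s v) = c * f' v)"
    using f'(2) by blast
qed

lemma scv_holomorphic_map_on_subset:
  "scv_holomorphic_map_on f S \<Longrightarrow> T \<subseteq> S \<Longrightarrow> scv_holomorphic_map_on f T"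
  by (auto simp: scv_holomorphic_map_on_def scv_holomorphic_on_def)

lemma locally_biholomorphic_mapE:
  assumes "locally_biholomorphic_map M A UNIV (std_charts UNIV) \<pi>" "x \<in> M"
  obtains U V where "x \<in> U" "openin (top_of_set M) U" "open V" "homeomorphism U V \<pi> (inv_into U \<pi>)"
    "biholomorphic_map U (restrict_charts A U) V {(V, id)} \<pi>"
proof -
  obtain U V where UV: "x \<in> U" "openin (top_of_set M) U" "open V"
    and bih: "biholomorphic_map U (restrict_charts A U) V {(V, id)} \<pi>"
    using assms unfolding locally_biholomorphic_map_def restrict_charts_def std_charts_def by auto
  then have "homeomorphism U V \<pi> (inv_into U \<pi>)"
    by (auto simp: biholomorphic_map_def holomorphic_map_def bij_betw_def homeomorphism_def)
  with UV bih show thesis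
    using that by blast
qed

text \<open>A local inverse of \<pi> carries a small ball onto a path connected neighbourhood, so
  path components are open, and connectedness leaves only one.\<close>

lemma connected_locally_biholomorphic_imp_path_connected:
  fixes M :: "'a::{t2_space,second_countable_topology} set" and A :: "('a, 'n::finite) charts"
  assumes "connected M" and loc: "locally_biholomorphic_map M A UNIV (std_charts UNIV) \<pi>"
  shows "path_connected M"
  unfolding path_connected_component
proof (intro ballI)
  fix a b assume "a \<in> M" "b \<in> M"
  then show "path_component M a b"
  proof (rule connected_equivalence_relation[OF \<open>connected M\<close>])
    fix x assume "x \<in> M"
    then obtain U V where U: "x \<in> U" "openin (top_of_set M) U" and V: "open V"
      and hom: "homeomorphism U V \<pi> (inv_into U \<pi>)"
      using locally_biholomorphic_mapE[OF loc] by metis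
    let ?g = "inv_into U \<pi>"
    have "\<pi> x \<in> V"
      using hom U(1) by (auto simp: homeomorphism_def)
    then obtain e where e: "e > 0" "ball (\<pi> x) e \<subseteq> V"
      using V open_contains_ball by blast
    let ?T = "?g ` ball (\<pi> x) e"
    have "openin (top_of_set U) ?T"
      by (rule homeomorphism_imp_open_map[OF homeomorphism_symD[OF hom]]) (use e V in \<open>auto simp: open_openin_trans\<close>)
    then have T: "openin (top_of_set M) ?T"
      using U(2) openin_trans by blast
    have "path_connected ?T"
      using hom e(2) by (intro path_connected_continuous_image)
        (auto simp: homeomorphism_def convex_imp_path_connected intro: continuous_on_subset)
    moreover have "x \<in> ?T"
      using hom U(1) e(1) by (auto simp: homeomorphism_def intro!: rev_image_eqI[of "\<pi> x"])
    ultimately have "\<forall>y\<in>?T. path_component M x y"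
      using openin_imp_subset[OF T] path_component_of_subset unfolding path_connected_component by metis
    then show "\<exists>T. openin (top_of_set M) T \<and> x \<in> T \<and> (\<forall>y\<in>T. path_component M x y)"
      using T \<open>x \<in> ?T\<close> by blast
  qed (auto intro: path_component_sym path_component_trans)
qed

lemma schlicht_if_inj_on:
  fixes M :: "'a::{t2_space,second_countable_topology} set" and A :: "('a, 'n::finite) charts"
  assumes man: "complex_manifold M A" and loc: "locally_biholomorphic_map M A UNIV (std_charts UNIV) \<pi>"
    and cont: "continuous_on M \<pi>" and inj: "inj_on \<pi> M"
  shows "schlicht M A \<pi>"
  unfolding schlicht_def biholomorphic_map_def
proof (intro conjI)
  let ?Y = "\<pi> ` M" and ?g = "inv_into M \<pi>"
  show "bij_betw \<pi> M ?Y"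
    using inj by (simp add: bij_betw_def)
  show "holomorphic_map M A ?Y (std_charts ?Y) \<pi>"
    unfolding holomorphic_map_def std_charts_def
  proof (intro conjI ballI cont order_refl, clarsimp)
    fix U' \<phi> assume U': "(U', \<phi>) \<in> A"
    have U'o: "openin (top_of_set M) U'" "open (\<phi> ` U')" "homeomorphism U' (\<phi> ` U') \<phi> (inv_into U' \<phi>)"
      using man U' by (auto simp: complex_manifold_def)
    have inj\<phi>: "inj_on \<phi> U'"
      using U'o(3) by (metis homeomorphism_def inj_on_inverseI)
    show "scv_holomorphic_map_on (\<pi> \<circ> inv_into U' \<phi>) (\<phi> ` (U' \<inter> \<pi> -` \<pi> ` M))"
    proof (rule scv_holomorphic_map_on_locallyI)
      fix z assume "z \<in> \<phi> ` (U' \<inter> \<pi> -` \<pi> ` M)"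
      then obtain x where x: "x \<in> U'" "z = \<phi> x"
        by auto
      then have "x \<in> M"
        using openin_imp_subset[OF U'o(1)] by blast
      then obtain U V where U: "x \<in> U" "openin (top_of_set M) U" and V: "open V"
        "homeomorphism U V \<pi> (inv_into U \<pi>)" and bih: "biholomorphic_map U (restrict_charts A U) V {(V, id)} \<pi>"
        using locally_biholomorphic_mapE[OF loc] by metis
      let ?T = "\<phi> ` (U' \<inter> U)"
      have "(U' \<inter> U, \<phi>) \<in> restrict_charts A U"
        using U' by (force simp: restrict_charts_def)
      then have "scv_holomorphic_map_on (\<pi> \<circ> inv_into (U' \<inter> U) \<phi>) (\<phi> ` (U' \<inter> U \<inter> \<pi> -` V))"
        using bih by (auto simp: biholomorphic_map_def holomorphic_map_def)
      moreover have "\<pi> x \<in> V"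
        using V(2) U(1) by (auto simp: homeomorphism_def)
      ultimately have "scv_holomorphic_map_on (\<pi> \<circ> inv_into (U' \<inter> U) \<phi>) {z}"
        using x U(1) by (auto intro: scv_holomorphic_map_on_subset)
      moreover have "openin (top_of_set U') (U' \<inter> U)"
        using U(2) openin_imp_subset[OF U'o(1)] by (auto simp: openin_open)
      then have "open ?T"
        using homeomorphism_imp_open_map[OF U'o(3)] U'o(2) openin_open_trans by blast
      moreover have "z \<in> ?T"
        using x U(1) by blast
      \<comment> \<open>The inverse of the restricted chart and that of the full chart agree on
        \<open>?T\<close> because \<phi> is injective on all of \<open>U'\<close>.\<close>
      moreover have "\<forall>w\<in>?T. (\<pi> \<circ> inv_into (U' \<inter> U) \<phi>) w = (\<pi> \<circ> inv_into U' \<phi>) w"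
        using inj\<phi> inj_on_subset[OF inj\<phi>, of "U' \<inter> U"] by auto
      ultimately show "\<exists>T g. open T \<and> z \<in> T \<and> (\<forall>w\<in>T. g w = (\<pi> \<circ> inv_into U' \<phi>) w) \<and> scv_holomorphic_map_on g {z}"
        by blast
    qed
  qed
  \<comment> \<open>Global injectivity identifies every local inverse of \<pi> with the global one,
    which thereby inherits continuity and holomorphy.\<close>
  have g_local: "inv_into U \<pi> w = ?g w"
    if "openin (top_of_set M) U" "homeomorphism U V \<pi> (inv_into U \<pi>)" "w \<in> V" for U V w
  proof -
    have "inv_into U \<pi> w \<in> M" "\<pi> (inv_into U \<pi> w) = w"
      using that openin_imp_subset[OF that(1)] by (auto simp: homeomorphism_def)
    then show ?thesis
      using inv_into_f_f[OF inj, of "inv_into U \<pi> w"] by simp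
  qed
  show "holomorphic_map ?Y (std_charts ?Y) M A ?g"
    unfolding holomorphic_map_def
  proof (intro conjI)
    show "continuous_on ?Y ?g"
    proof (rule continuous_at_imp_continuous_on, clarify)
      fix x assume "x \<in> M"
      then obtain U V where U: "x \<in> U" "openin (top_of_set M) U" and V: "open V"
        "homeomorphism U V \<pi> (inv_into U \<pi>)"
        using locally_biholomorphic_mapE[OF loc] by metis
      have "continuous_on V (inv_into U \<pi>)"
        using V(2) by (simp add: homeomorphism_def)
      then have "continuous_on V ?g"
        by (rule continuous_on_eq) (rule g_local[OF U(2) V(2)])
      moreover have "\<pi> x \<in> V"
        using V(2) U(1) by (auto simp: homeomorphism_def)
      ultimately show "isCont ?g (\<pi> x)"
        using V(1) continuous_on_eq_continuous_at by blast
    qed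
    show "?g ` ?Y \<subseteq> M"
      by (auto intro: inv_into_into)
    have "scv_holomorphic_map_on (\<phi> \<circ> ?g \<circ> inv_into ?Y id) (id ` (?Y \<inter> ?g -` U'))" if U': "(U', \<phi>) \<in> A" for U' \<phi>
    proof (rule scv_holomorphic_map_on_locallyI)
      fix z assume "z \<in> id ` (?Y \<inter> ?g -` U')"
      then obtain x where x: "x \<in> M" "x \<in> U'" "z = \<pi> x"
        using inj by auto
      obtain U V where U: "x \<in> U" "openin (top_of_set M) U" and V: "open V"
        "homeomorphism U V \<pi> (inv_into U \<pi>)" and bih: "biholomorphic_map U (restrict_charts A U) V {(V, id)} \<pi>"
        using locally_biholomorphic_mapE[OF loc x(1)] by metis
      let ?h = "\<phi> \<circ> inv_into U \<pi> \<circ> inv_into V id"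
      have "(U' \<inter> U, \<phi>) \<in> restrict_charts A U"
        using U' by (force simp: restrict_charts_def)
      then have "scv_holomorphic_map_on ?h (id ` (V \<inter> inv_into U \<pi> -` (U' \<inter> U)))"
        using bih unfolding biholomorphic_map_def holomorphic_map_def by blast
      moreover have zV: "z \<in> V" "inv_into U \<pi> z = x"
        using V(2) U(1) x by (auto simp: homeomorphism_def)
      ultimately have "scv_holomorphic_map_on ?h {z}"
        using x U(1) by (auto intro: scv_holomorphic_map_on_subset)
      moreover have "?h w = (\<phi> \<circ> ?g \<circ> inv_into ?Y id) w" if "w \<in> V" for w
      proof -
        have "w \<in> ?Y"
          using V(2) that openin_imp_subset[OF U(2)] by (auto simp: homeomorphism_def)
        then show ?thesis
          using g_local[OF U(2) V(2) that] that inv_into_f_f[of id V w] inv_into_f_f[of id ?Y w] by simp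
      qed
      ultimately show "\<exists>T h. open T \<and> z \<in> T \<and> (\<forall>w\<in>T. h w = (\<phi> \<circ> ?g \<circ> inv_into ?Y id) w) \<and> scv_holomorphic_map_on h {z}"
        using V(1) zV(1) by blast
    qed
    then show "\<forall>(U, \<phi>)\<in>std_charts ?Y. \<forall>(V, \<psi>)\<in>A.
        scv_holomorphic_map_on (\<psi> \<circ> ?g \<circ> inv_into U \<phi>) (\<phi> ` (U \<inter> ?g -` V))"
      by (auto simp: std_charts_def)
  qed
qed

section \<open>Schlicht envelopes\<close>

theorem theorem3:
  fixes \<Omega> :: "(complex^'n) set"
    and M :: "'a::{t2_space,second_countable_topology} set"
    and A :: "('a, 'n) charts"
    and \<pi> :: "'a \<Rightarrow> complex^'n"
    and \<alpha> :: "complex^'n \<Rightarrow> 'a"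
    and x\<^sub>0 :: "complex^'n"
  assumes "open \<Omega>" and "connected \<Omega>" and "\<Omega> \<noteq> {}"
    and "envelope_of_holomorphy \<Omega> M A \<pi> \<alpha>"
    and "covering_space M \<pi> (\<pi> ` M)"
    and "x\<^sub>0 \<in> \<pi> ` M" and "nilpotent_group (fundamental_group (\<pi> ` M) x\<^sub>0)"
    and "\<And>G :: (complex^'n) chain monoid. comm_group G \<Longrightarrow>
           inj_on (cohomology_induced 1 (top_of_set \<Omega>) G (\<pi> \<circ> \<alpha>))
             (carrier (cohomology_group 1 (top_of_set (\<pi> ` M)) G))"
  shows "schlicht M A \<pi>"
proof -
  let ?Y = "\<pi> ` M"
  note env = assms(4)[unfolded envelope_of_holomorphy_def] and cov = assms(5)
  have man: "complex_manifold M A" and loc: "locally_biholomorphic_map M A UNIV (std_charts UNIV) \<pi>"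
    and "connected M" and \<alpha>: "continuous_on \<Omega> \<alpha>" "\<alpha> ` \<Omega> \<subseteq> M" and \<pi>\<alpha>: "\<And>z. z \<in> \<Omega> \<Longrightarrow> \<pi> (\<alpha> z) = z"
    using env by (auto simp: stein_manifold_def holomorphic_map_def)
  have cont: "continuous_on M \<pi>"
    using cov by (rule covering_space_imp_continuous)
  have pcM: "path_connected M"
    using connected_locally_biholomorphic_imp_path_connected[OF \<open>connected M\<close> loc] .
  \<comment> \<open>A set-theoretic section of \<pi>, arbitrary off \<Omega> but equal to \<alpha>
    on \<Omega>. The second property is what makes the lifted paths below fit together over
    \<Omega>.\<close>
  define s where "s y = (if y \<in> \<Omega> then \<alpha> y else inv_into M \<pi> y)" for y
  have s: "s y \<in> M" "\<pi> (s y) = y" if "y \<in> ?Y" for y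
    using that \<alpha> \<pi>\<alpha> by (auto simp: s_def inv_into_into f_inv_into_f)
  define m where "m = s x\<^sub>0"
  have m: "m \<in> M" "\<pi> m = x\<^sub>0"
    using s assms(6) by (auto simp: m_def)
  define H where "H = image_fundamental_group M m ?Y \<pi>"
  have H: "subgroup H (fundamental_group ?Y x\<^sub>0)"
    using subgroup_image_fundamental_group[OF m(1) cont] by (simp add: H_def m(2))
  have "\<exists>d. path d \<and> path_image d \<subseteq> M \<and> pathstart d = m \<and> pathfinish d = s y" if "y \<in> ?Y" for y
    using pcM m(1) s(1)[OF that] unfolding path_connected_def by blast
  then obtain \<delta> where \<delta>: "\<And>y. y \<in> ?Y \<Longrightarrow> path (\<delta> y)" "\<And>y. y \<in> ?Y \<Longrightarrow> path_image (\<delta> y) \<subseteq> M"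
    "\<And>y. y \<in> ?Y \<Longrightarrow> pathstart (\<delta> y) = m" "\<And>y. y \<in> ?Y \<Longrightarrow> pathfinish (\<delta> y) = s y"
    by metis
  have f: "continuous_map (top_of_set \<Omega>) (top_of_set ?Y) (\<pi> \<circ> \<alpha>)"
    using continuous_on_compose2[OF cont \<alpha>] \<alpha>(2) by auto
  have "H = carrier (fundamental_group ?Y x\<^sub>0)"
  proof (rule nilpotent_group_eq_subgroupI[OF assms(7) H])
    fix N assume N: "N \<lhd> fundamental_group ?Y x\<^sub>0" and comm: "comm_group (fundamental_group ?Y x\<^sub>0 Mod N)"
      and HN: "H \<subseteq> N"
    show "N = carrier (fundamental_group ?Y x\<^sub>0)"
    proof (rule abelian_quotient_of_fundamental_group_trivial[OF assms(6) N comm, where \<gamma> = "\<lambda>y. \<pi> \<circ> \<delta> y", OF _ _ _ _ f])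
      show "inj_on (cohomology_induced (Suc 0) (top_of_set \<Omega>) (fundamental_group ?Y x\<^sub>0 Mod N) (\<pi> \<circ> \<alpha>))
          (carrier (cohomology_group (Suc 0) (top_of_set ?Y) (fundamental_group ?Y x\<^sub>0 Mod N)))"
        using inj_cohomology_induced_any_type[OF f _ comm, of 0] assms(8) by simp
      fix \<sigma> assume \<sigma>: "singular_simplex (Suc 0) (top_of_set \<Omega>) \<sigma>"
      let ?p = "simplex_path \<sigma>"
      let ?a = "pathstart ?p" and ?b = "pathfinish ?p"
      \<comment> \<open>This loop in \<open>M\<close> projects to the closed-up simplex: over
        \<Omega> the path \<open>\<delta> ?a\<close> ends at \<open>\<alpha> ?a\<close>, where the
        lift of the simplex through \<alpha> begins, and likewise at \<open>?b\<close>. Hence the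
        class lies in \<open>H\<close>.\<close>
      let ?l = "\<delta> ?a +++ (\<alpha> \<circ> ?p) +++ reversepath (\<delta> ?b)"
      note sp = simplex_path[OF \<sigma>]
      have ab: "?a \<in> \<Omega>" "?b \<in> \<Omega>"
        using sp(2) pathstart_in_path_image pathfinish_in_path_image by blast+
      have abY: "?a \<in> ?Y" "?b \<in> ?Y"
        using ab \<alpha>(2) \<pi>\<alpha> by (metis image_subset_iff imageI)+
      have "path (\<alpha> \<circ> ?p)" "path_image (\<alpha> \<circ> ?p) \<subseteq> M"
        using sp \<alpha> by (auto simp: path_image_compose intro!: path_continuous_image intro: continuous_on_subset)
      then have "?l \<in> loops_at M m"
        using \<delta>[OF abY(1)] \<delta>[OF abY(2)] ab
        by (simp add: loops_at_def path_image_join pathstart_compose pathfinish_compose s_def)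
      then have "path_class ?Y (\<pi> \<circ> ?l) \<in> H"
        by (auto simp: H_def image_fundamental_group_def)
      then have "path_class ?Y (\<pi> \<circ> ?l) \<in> N"
        using HN by blast
      then show "path_class ?Y ((\<pi> \<circ> \<delta> ((\<pi> \<circ> \<alpha>) ?a)) +++ (\<pi> \<circ> \<alpha> \<circ> ?p) +++ reversepath (\<pi> \<circ> \<delta> ((\<pi> \<circ> \<alpha>) ?b))) \<in> N"
        using \<pi>\<alpha> ab by (simp add: path_compose_join path_compose_reversepath o_assoc)
    qed (use \<delta> s m cont in \<open>auto simp: path_image_compose pathstart_compose pathfinish_compose
        intro!: path_continuous_image intro: continuous_on_subset\<close>)
  qed
  then have "inj_on \<pi> M"
    using covering_space_inj_on_if_surjective[OF cov pcM m(1)] by (simp add: H_def m(2))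
  then show ?thesis
    by (rule schlicht_if_inj_on[OF man loc cont])
qed

end
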